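(* For any $\alpha,\beta\in L^1_{\mathrm{loc}}(\mathbb{R})$, the differential equation $$y''+\alpha y'+\beta y=0$$ on $\mathbb{R}$ has general solution $$y=y(0)\,C_{f,g}+y'(0)\,S_{g,f}\qquad\text{where}\quad f=-\beta e^{P\alpha}\ \text{ and }\ g=e^{-P\alpha}.$$ That is, for every choice of $y(0),y'(0)\in\mathbb{C}$ this formula defines a solution with these initial values, and every solution is of this form.
   Context: $L^1_{\mathrm{loc}}(\mathbb{R})$ denotes the space of locally integrable complex valued functions on $\mathbb{R}$. For $u\in L^1_{\mathrm{loc}}(\mathbb{R})$, $Pu(x)=\int_0^x u$. A solution of the second order equation is a continuously differentiable function $y:\mathbb{R}\to\mathbb{C}$ such that $y'$ is locally absolutely continuous and the equation holds almost everywhere. For $u,v\in L^1_{\mathrm{loc}}(\mathbb{R})$ and $j\ge 1$ let $T^{(j)}_{u,v}(s_1,\ldots,s_j)=u(s_1)v(s_2)u(s_3)\cdots$ ($j$ factors, alternating $u$ with $v$, beginning with $u$). Set $A_0(u,v,x)=1$ and, for $j\geq 1$, $$A_j(u,v,x)=\int_{0<s_1<\cdots<s_j<x}T^{(j)}_{u,v}(s_1,\ldots,s_j)\,ds_1\cdots ds_j\quad (x\ge 0),$$ $$A_j(u,v,x)=(-1)^j\int_{x<s_j<\cdots<s_1<0}T^{(j)}_{u,v}(s_1,\ldots,s_j)\,ds_1\cdots ds_j\quad (x\le 0).$$ The bivariate exponential is $E_{u,v}(x)=1+\sum_{j=1}^\infty A_j(u,v,x)$ for $x\in\mathbb{R}$,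 and $$C_{u,v}=\tfrac12\bigl(E_{u,v}+E_{-u,-v}\bigr),\qquad S_{u,v}=\tfrac12\bigl(E_{u,v}-E_{-u,-v}\bigr).$$ *)

theory Defs
  imports "HOL-Analysis.Analysis"
begin

definition L1_loc :: "(real \<Rightarrow> complex) set" where
  "L1_loc = {u. \<forall>K. compact K \<longrightarrow> u absolutely_integrable_on K}"

text \<open>\<open>prim u x\<close> is the signed integral of \<open>u\<close> from 0 to \<open>x\<close> (negated when \<open>x < 0\<close>), written
  \<open>Pu(x)\<close> in the literature.\<close>

definition prim :: "(real \<Rightarrow> complex) \<Rightarrow> real \<Rightarrow> complex" where
  "prim u x = (LINT t=0..ereal x|lebesgue. u t)"

definition abs_continuous_on :: "(real \<Rightarrow> complex) \<Rightarrow> real \<Rightarrow> real \<Rightarrow> bool" where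
  "abs_continuous_on F a b \<longleftrightarrow>
     (\<forall>\<epsilon>>0. \<exists>\<delta>>0. \<forall>D :: (real \<times> real) set.
        finite D \<longrightarrow>
        (\<forall>(p, q)\<in>D. a \<le> p \<and> p \<le> q \<and> q \<le> b) \<longrightarrow>
        disjoint_family_on (\<lambda>(p, q). {p<..<q}) D \<longrightarrow>
        (\<Sum>(p, q)\<in>D. q - p) < \<delta> \<longrightarrow>
        (\<Sum>(p, q)\<in>D. norm (F q - F p)) < \<epsilon>)"

definition locally_abs_continuous :: "(real \<Rightarrow> complex) \<Rightarrow> bool" where
  "locally_abs_continuous F \<longleftrightarrow> (\<forall>a b. a \<le> b \<longrightarrow> abs_continuous_on F a b)"

definition is_solution :: "(real \<Rightarrow> complex) \<Rightarrow> (real \<Rightarrow> complex) \<Rightarrow> (real \<Rightarrow> complex) \<Rightarrow> bool" where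
  "is_solution \<alpha> \<beta> y \<longleftrightarrow>
     (let y' = (\<lambda>x. vector_derivative y (at x)) in
        y C1_differentiable_on UNIV \<and>
        locally_abs_continuous y' \<and>
        (AE x in lebesgue. y' differentiable (at x) \<and>
           vector_derivative y' (at x) + \<alpha> x * y' x + \<beta> x * y x = 0))"

definition alt_prod :: "(real \<Rightarrow> complex) \<Rightarrow> (real \<Rightarrow> complex) \<Rightarrow> nat \<Rightarrow> (nat \<Rightarrow> real) \<Rightarrow> complex" where
  "alt_prod u v j s = (\<Prod>i=1..j. if odd i then u (s i) else v (s i))"

text \<open>Points \<open>(s\<^sub>1, \<dots>, s\<^sub>j)\<close> of \<open>\<real>\<^sup>j\<close> are functions in the product space over the index set
  \<open>{1..j}\<close>. The product is taken over \<open>lebesgue\<close> rather than \<open>lborel\<close>, so that the integrand is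
  measurable for merely Lebesgue measurable \<open>u\<close> and \<open>v\<close>.\<close>

abbreviation leb_pow :: "nat \<Rightarrow> (nat \<Rightarrow> real) measure" where
  "leb_pow j \<equiv> (\<Pi>\<^sub>M i\<in>{1..j}. lebesgue)"

definition simplex_pos :: "nat \<Rightarrow> real \<Rightarrow> (nat \<Rightarrow> real) set" where
  "simplex_pos j x =
     {s \<in> space (leb_pow j). 0 < s 1 \<and> (\<forall>i\<in>{1..<j}. s i < s (Suc i)) \<and> s j < x}"

definition simplex_neg :: "nat \<Rightarrow> real \<Rightarrow> (nat \<Rightarrow> real) set" where
  "simplex_neg j x =
     {s \<in> space (leb_pow j). x < s j \<and> (\<forall>i\<in>{1..<j}. s (Suc i) < s i) \<and> s 1 < 0}"

text \<open>For \<open>j \<ge> 1\<close> both simplices are empty at \<open>x = 0\<close>, so the two cases agree there.\<close>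

definition A_term :: "nat \<Rightarrow> (real \<Rightarrow> complex) \<Rightarrow> (real \<Rightarrow> complex) \<Rightarrow> real \<Rightarrow> complex" where
  "A_term j u v x =
     (if j = 0 then 1
      else if 0 \<le> x then (LINT s:simplex_pos j x|leb_pow j. alt_prod u v j s)
      else (- 1) ^ j * (LINT s:simplex_neg j x|leb_pow j. alt_prod u v j s))"

definition E_biv :: "(real \<Rightarrow> complex) \<Rightarrow> (real \<Rightarrow> complex) \<Rightarrow> real \<Rightarrow> complex" where
  "E_biv u v x = 1 + (\<Sum>j. A_term (Suc j) u v x)"

definition C_biv :: "(real \<Rightarrow> complex) \<Rightarrow> (real \<Rightarrow> complex) \<Rightarrow> real \<Rightarrow> complex" where
  "C_biv u v x = (E_biv u v x + E_biv (\<lambda>t. - u t) (\<lambda>t. - v t) x) / 2"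

definition S_biv :: "(real \<Rightarrow> complex) \<Rightarrow> (real \<Rightarrow> complex) \<Rightarrow> real \<Rightarrow> complex" where
  "S_biv u v x = (E_biv u v x - E_biv (\<lambda>t. - u t) (\<lambda>t. - v t) x) / 2"

end

theory Submission
  imports Defs
begin

text \<open>
  The iterated integrals satisfy \<open>A\<^sub>j\<^sub>+\<^sub>1' = w A\<^sub>j\<close> almost everywhere, where \<open>w\<close> is \<open>u\<close> or \<open>v\<close> according
  to the parity of \<open>j\<close>. Hence the even and odd parts of the exponential series solve the first order system
  \<open>C\<^sub>u\<^sub>,\<^sub>v' = v S\<^sub>u\<^sub>,\<^sub>v\<close>, \<open>S\<^sub>u\<^sub>,\<^sub>v' = u C\<^sub>u\<^sub>,\<^sub>v\<close>, and with \<open>Z = e\<^sup>P\<^sup>\<alpha> y'\<close> the differential equation is the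
  system \<open>y' = g Z\<close>, \<open>Z' = f y\<close>. Uniqueness follows because
  \<open>y C\<^sub>g\<^sub>,\<^sub>f - Z S\<^sub>g\<^sub>,\<^sub>f\<close>, \<open>Z C\<^sub>f\<^sub>,\<^sub>g - y S\<^sub>f\<^sub>,\<^sub>g\<close> and \<open>C\<^sub>f\<^sub>,\<^sub>g C\<^sub>g\<^sub>,\<^sub>f - S\<^sub>f\<^sub>,\<^sub>g S\<^sub>g\<^sub>,\<^sub>f = 1\<close>
  are absolutely continuous with zero derivative almost everywhere, hence constant.
\<close>

section \<open>Locally integrable functions and their primitives\<close>

text \<open>A derivative that vanishes almost everywhere does not by itself force a function to be
  constant, as the Cantor function shows, so every differential identity has to travel together with
  absolute continuity. The predicate \<open>ac_deriv\<close> couples the two; it obeys the product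
  and chain rules and turns uniqueness into computation. The functions in the uniqueness argument
  come from the matrix with columns \<open>(C_biv f g, S_biv f g)\<close> and
  \<open>(S_biv g f, C_biv g f)\<close>. It is the fundamental matrix of the system for
  \<open>(y, Z)\<close>, equal to the identity at 0. The coefficient matrix has trace zero, so the
  determinant stays 1, and the other two functions are the entries of the inverse matrix applied to
  \<open>(y, Z)\<close>. A gap remains between the system, which holds almost everywhere, and the
  demand that \<open>y\<close> be continuously differentiable everywhere. It closes because the
  right side \<open>g Z\<close> of the first equation is continuous.\<close>

lemma L1_loc_absolutely_integrable:
  assumes "u \<in> L1_loc" shows "u absolutely_integrable_on {a..b}"
  using assms by (auto simp: L1_loc_def)

lemma L1_loc_integrable:
  assumes "u \<in> L1_loc" shows "u integrable_on {a..b}"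
  using L1_loc_absolutely_integrable[OF assms] set_lebesgue_integral_eq_integral(1) by blast

lemma L1_locI:
  assumes "\<And>a b. u absolutely_integrable_on {a..b}" shows "u \<in> L1_loc"
  unfolding L1_loc_def
proof safe
  fix K :: "real set" assume K: "compact K"
  obtain a where "K \<subseteq> cbox (-a) a"
    using bounded_subset_cbox_symmetric[OF compact_imp_bounded[OF K]] .
  then have "K \<subseteq> {-a..a}" by simp
  then show "u absolutely_integrable_on K"
    using fmeasurableD[OF lmeasurable_compact[OF K]] by (rule set_integrable_subset[OF assms, rotated])
qed

text \<open>Passes from the Lebesgue integral over the open interval to the gauge integral over the
  closed one, where additivity over intervals and the differentiation theorem are applied below.
  Absolute integrability makes the two integrals agree.\<close>

lemma prim_nonneg:
  assumes "u \<in> L1_loc" "0 \<le> x" shows "prim u x = integral {0..x} u"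
proof -
  have "u absolutely_integrable_on {0<..<x}"
    by (rule set_integrable_subset[OF L1_loc_absolutely_integrable[OF assms(1), of 0 x]]) auto
  then have "set_lebesgue_integral lebesgue {0<..<x} u = integral {0<..<x} u"
    by (rule set_lebesgue_integral_eq_integral)
  then show ?thesis
    using assms(2) by (simp add: prim_def interval_lebesgue_integral_def integral_open_interval_real zero_ereal_def)
qed

lemma prim_nonpos:
  assumes "u \<in> L1_loc" "x \<le> 0" shows "prim u x = - integral {x..0} u"
proof -
  have "u absolutely_integrable_on {x<..<0}"
    by (rule set_integrable_subset[OF L1_loc_absolutely_integrable[OF assms(1), of x 0]]) auto
  then have "set_lebesgue_integral lebesgue {x<..<0} u = integral {x<..<0} u"
    by (rule set_lebesgue_integral_eq_integral)
  then show ?thesis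
    using assms(2) by (cases "x = 0") (auto simp add: prim_def interval_lebesgue_integral_def integral_open_interval_real zero_ereal_def)
qed

lemma prim_0 [simp]: "prim u 0 = 0"
  by (simp add: prim_def interval_lebesgue_integral_def zero_ereal_def set_lebesgue_integral_def)

lemma prim_diff:
  assumes "u \<in> L1_loc" "a \<le> b" shows "prim u b - prim u a = integral {a..b} u"
proof -
  note i = L1_loc_integrable[OF assms(1)]
  consider "0 \<le> a" | "a \<le> 0" "0 \<le> b" | "b \<le> 0" by linarith
  then show ?thesis
  proof cases
    case 1
    have "integral {0..a} u + integral {a..b} u = integral {0..b} u"
      using 1 assms i by (intro Henstock_Kurzweil_Integration.integral_combine) auto
    then show ?thesis using 1 assms by (simp add: prim_nonneg algebra_simps)
  next
    case 2
    have "integral {a..0} u + integral {0..b} u = integral {a..b} u"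
      using 2 assms i by (intro Henstock_Kurzweil_Integration.integral_combine) auto
    then show ?thesis using 2 assms by (simp add: prim_nonneg prim_nonpos add.commute)
  next
    case 3
    have "integral {a..b} u + integral {b..0} u = integral {a..0} u"
      using 3 assms i by (intro Henstock_Kurzweil_Integration.integral_combine) auto
    then show ?thesis using 3 assms by (simp add: prim_nonpos algebra_simps)
  qed
qed

lemma L1_loc_continuous_mult:
  assumes "u \<in> L1_loc" "continuous_on UNIV c" shows "(\<lambda>x. c x * u x) \<in> L1_loc"
proof (rule L1_locI)
  fix a b :: real
  have c: "continuous_on {a..b} c" using assms(2) continuous_on_subset by blast
  show "(\<lambda>x. c x * u x) absolutely_integrable_on {a..b}"
  proof (rule absolutely_integrable_bounded_measurable_product[where h="(*)"])
    show "bounded (c ` {a..b})"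
      using c compact_continuous_image compact_imp_bounded by blast
    show "c \<in> borel_measurable (lebesgue_on {a..b})"
      using c by (intro continuous_imp_measurable_on_sets_lebesgue) auto
  qed (use assms L1_loc_absolutely_integrable bilinear_times in auto)
qed

lemma L1_loc_cmult: "u \<in> L1_loc \<Longrightarrow> (\<lambda>x. c * u x) \<in> L1_loc"
  by (rule L1_loc_continuous_mult[OF _ continuous_on_const])

lemma L1_loc_add: "u \<in> L1_loc \<Longrightarrow> v \<in> L1_loc \<Longrightarrow> (\<lambda>x. u x + v x) \<in> L1_loc"
  by (rule L1_locI, rule set_integral_add) (auto dest: L1_loc_absolutely_integrable)

lemma L1_loc_continuous:
  assumes "continuous_on UNIV u" shows "u \<in> L1_loc"
  by (rule L1_locI) (metis absolutely_integrable_continuous_real assms continuous_on_subset subset_UNIV)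

lemma L1_loc_norm:
  assumes "u \<in> L1_loc" shows "(\<lambda>x. complex_of_real (norm (u x))) \<in> L1_loc"
proof (rule L1_locI)
  fix a b :: real
  have "integrable lebesgue (\<lambda>x. norm (indicat_real {a..b} x *\<^sub>R u x))"
    using L1_loc_absolutely_integrable[OF assms, of a b] unfolding set_integrable_def
    by (rule integrable_norm)
  then have "integrable lebesgue (\<lambda>x. complex_of_real (norm (indicat_real {a..b} x *\<^sub>R u x)))"
    by (rule integrable_of_real)
  then show "(\<lambda>x. complex_of_real (norm (u x))) absolutely_integrable_on {a..b}"
    unfolding set_integrable_def
    by (rule back_subst[of "integrable lebesgue"]) (auto simp: indicator_def)
qed

text \<open>Lebesgue differentiation. \<open>integrable_ccontinuous_explicit\<close> controls
  averages over intervals to the right of a point; the averages to the left are right averages of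
  the reflected function, so the exceptional set is the union of one null set and the mirror image
  of another.\<close>

lemma AE_prim_has_vector_derivative:
  assumes u: "u \<in> L1_loc"
  shows "AE x in lebesgue. (prim u has_vector_derivative u x) (at x)"
proof -
  have "u integrable_on cbox a b" for a b using L1_loc_integrable[OF u] by simp
  then obtain N1 where N1: "negligible N1" and right:
    "\<And>x e. x \<notin> N1 \<Longrightarrow> 0 < e \<Longrightarrow>
       \<exists>d>0. \<forall>h. 0 < h \<and> h < d \<longrightarrow> norm (integral {x..x + h} u /\<^sub>R h - u x) < e"
    using integrable_ccontinuous_explicit[of u] by auto
  have "(\<lambda>x. u (- x)) integrable_on cbox a b" for a b
    using L1_loc_integrable[OF u, of "-b" "-a"] Henstock_Kurzweil_Integration.integrable_reflect_real[where f=u and a="-b" and b="-a"] by simp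
  then obtain N2 where N2: "negligible N2" and left:
    "\<And>x e. x \<notin> N2 \<Longrightarrow> 0 < e \<Longrightarrow>
       \<exists>d>0. \<forall>h. 0 < h \<and> h < d \<longrightarrow> norm (integral {x..x + h} (\<lambda>x. u (- x)) /\<^sub>R h - u (- x)) < e"
    using integrable_ccontinuous_explicit[of "\<lambda>x. u (- x)"] by auto
  have "negligible (uminus ` N2)"
  proof (rule negligible_locally_Lipschitz_image[OF _ N2])
    fix x show "\<exists>T B. open T \<and> x \<in> T \<and> (\<forall>y\<in>N2 \<inter> T. norm (- y - - x) \<le> B * norm (y - x))"
      by (intro exI[of _ UNIV] exI[of _ 1]) auto
  qed simp
  with N1 have N: "N1 \<union> uminus ` N2 \<in> null_sets lebesgue"
    using negligible_Un negligible_iff_null_sets by blast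
  show ?thesis
  proof (rule AE_I'[OF N], safe, rule ccontr)
    fix x assume nd: "\<not> (prim u has_vector_derivative u x) (at x)" and x1: "x \<notin> N1" and x2: "x \<notin> uminus ` N2"
    have x2': "- x \<notin> N2" using x2 by force
    have "(prim u has_vector_derivative u x) (at x)"
      unfolding has_vector_derivative_def has_derivative_at_alt
    proof (intro conjI allI impI)
      show "bounded_linear (\<lambda>xa. xa *\<^sub>R u x)" by (rule bounded_linear_scaleR_left)
    next
      fix e :: real assume e: "0 < e"
      obtain d1 where d1: "d1 > 0" "\<And>h. 0 < h \<Longrightarrow> h < d1 \<Longrightarrow> norm (integral {x..x + h} u /\<^sub>R h - u x) < e"
        using right[OF x1 e] by blast
      obtain d2 where d2: "d2 > 0" "\<And>h. 0 < h \<Longrightarrow> h < d2 \<Longrightarrow>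
          norm (integral {- x..- x + h} (\<lambda>x. u (- x)) /\<^sub>R h - u x) < e"
        using left[OF x2' e] by auto
      have scale: "norm (I - h *\<^sub>R u x) \<le> e * h" if "0 < h" "norm (I /\<^sub>R h - u x) < e" for I h
      \<comment> \<open>Multiplying the estimate for the average by the length \<open>h\<close>
        gives the increment form used in the definition of the derivative.\<close>
      proof -
        have "I - h *\<^sub>R u x = h *\<^sub>R (I /\<^sub>R h - u x)" using that by (simp add: scaleR_diff_right)
        then have "norm (I - h *\<^sub>R u x) = h * norm (I /\<^sub>R h - u x)" using that by simp
        then show ?thesis using that by (simp add: mult.commute)
      qed
      show "\<exists>d>0. \<forall>y. norm (y - x) < d \<longrightarrow>
          norm (prim u y - prim u x - (y - x) *\<^sub>R u x) \<le> e * norm (y - x)"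
      proof (intro exI[of _ "min d1 d2"] conjI allI impI)
        fix y assume y: "norm (y - x) < min d1 d2"
        consider "y = x" | "x < y" | "y < x" by linarith
        then show "norm (prim u y - prim u x - (y - x) *\<^sub>R u x) \<le> e * norm (y - x)"
        proof cases
          case 2
          then show ?thesis
            using scale[OF _ d1(2)[of "y - x"]] y prim_diff[OF u, of x y] by simp
        next
          case 3
          have "integral {- x..- y} (\<lambda>x. u (- x)) = integral {y..x} u"
            by (rule Henstock_Kurzweil_Integration.integral_reflect_real)
          then have "norm (prim u x - prim u y - (x - y) *\<^sub>R u x) \<le> e * (x - y)"
            using scale[OF _ d2(2)[of "x - y"]] y prim_diff[OF u, of y x] 3 by simp
          moreover have "prim u y - prim u x - (y - x) *\<^sub>R u x = - (prim u x - prim u y - (x - y) *\<^sub>R u x)"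
            by (simp add: algebra_simps)
          ultimately show ?thesis using 3 by (metis abs_minus_commute abs_of_pos diff_gt_0_iff_gt norm_minus_cancel real_norm_def)
        qed simp
      qed (use d1 d2 in auto)
    qed
    then show False using nd by blast
  qed
qed

section \<open>Absolute continuity\<close>

text \<open>The tails are dominated by \<open>norm (U x)\<close> and vanish pointwise once
  \<open>n\<close> exceeds it, so dominated convergence applies. This splits an integrable function
  into a bounded part and a part of small integral.\<close>

lemma integrable_truncation_small:
  fixes U :: "'a \<Rightarrow> 'b::{banach, second_countable_topology}"
  assumes "integrable M U" "0 < e"
  obtains n :: nat where "(\<integral>x. (if real n < norm (U x) then norm (U x) else 0) \<partial>M) < e"
proof -
  note [measurable] = borel_measurable_integrable[OF assms(1)]
  have "(\<lambda>n. \<integral>x. (if real n < norm (U x) then norm (U x) else 0) \<partial>M) \<longlonglongrightarrow> (\<integral>x. 0 \<partial>M)"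
  proof (rule integral_dominated_convergence[where w="\<lambda>x. norm (U x)"])
    show "AE x in M. (\<lambda>n. if real n < norm (U x) then norm (U x) else 0) \<longlonglongrightarrow> 0"
    proof (rule AE_I2)
      fix x
      have "eventually (\<lambda>n. (if real n < norm (U x) then norm (U x) else 0) = 0) sequentially"
        using eventually_ge_at_top[of "nat \<lceil>norm (U x)\<rceil>"] 
        by eventually_elim (simp add: nat_le_iff ceiling_le_iff not_less)
      then show "(\<lambda>n. if real n < norm (U x) then norm (U x) else 0) \<longlonglongrightarrow> 0"
        by (rule tendsto_eventually)
    qed
  qed (use assms in auto)
  then have "eventually (\<lambda>n. (\<integral>x. (if real n < norm (U x) then norm (U x) else 0) \<partial>M) < e) sequentially"
    using assms(2) by (intro order_tendstoD(2)) auto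
  then show ?thesis using that by (auto simp: eventually_sequentially)
qed

text \<open>On \<open>{a..b}\<close> the norm of \<open>u\<close> is at most
  \<open>\<phi> + n\<close>, with \<open>\<phi>\<close> the tail above level \<open>n\<close>. Over
  disjoint intervals the tail costs at most its total integral, however long they are, and the
  constant \<open>n\<close> costs \<open>n\<close> times the total length.\<close>

lemma abs_continuous_on_prim:
  assumes u: "u \<in> L1_loc" shows "abs_continuous_on (prim u) a b"
  unfolding abs_continuous_on_def
proof (intro allI impI)
  fix \<epsilon> :: real assume e: "0 < \<epsilon>"
  define U where "U = (\<lambda>x. indicat_real {a..b} x *\<^sub>R u x)"
  have U: "integrable lebesgue U"
    using L1_loc_absolutely_integrable[OF u, of a b] by (simp add: U_def set_integrable_def)
  note [measurable] = borel_measurable_integrable[OF U]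
  obtain n :: nat where n: "(\<integral>x. (if real n < norm (U x) then norm (U x) else 0) \<partial>lebesgue) < \<epsilon> / 2"
    using integrable_truncation_small[OF U, of "\<epsilon> / 2"] e by auto
  define \<phi> where "\<phi> = (\<lambda>x. if real n < norm (U x) then norm (U x) else 0)"
  have \<phi>: "integrable lebesgue \<phi>"
    unfolding \<phi>_def by (rule Bochner_Integration.integrable_bound[OF U]) auto
  have \<phi>0: "0 \<le> \<phi> x" for x by (simp add: \<phi>_def)
  have ind: "integrable lebesgue (\<lambda>x. indicat_real {p<..<q} x * f x)"
    if "integrable lebesgue f" for p q and f :: "real \<Rightarrow> real"
    using integrable_mult_indicator[OF _ that, of "{p<..<q}"] by simp
  have step: "norm (prim u q - prim u p) \<le>
      (\<integral>x. indicat_real {p<..<q} x * \<phi> x \<partial>lebesgue) + real n * (q - p)"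
    if "a \<le> p" "p \<le> q" "q \<le> b" for p q :: real
  proof -
    have si: "set_integrable lebesgue {p<..<q} u"
      by (rule set_integrable_subset[OF L1_loc_absolutely_integrable[OF u, of p q]]) auto
    have "prim u q - prim u p = integral {p<..<q} u"
      using prim_diff[OF u that(2)] by (simp add: integral_open_interval_real)
    also have "\<dots> = (\<integral>x. indicat_real {p<..<q} x *\<^sub>R u x \<partial>lebesgue)"
      using set_lebesgue_integral_eq_integral(2)[OF si] by (simp add: set_lebesgue_integral_def)
    also have "\<dots> = (\<integral>x. indicat_real {p<..<q} x *\<^sub>R U x \<partial>lebesgue)"
      using that by (intro Bochner_Integration.integral_cong) (auto simp: U_def indicator_def)
    finally have "norm (prim u q - prim u p) \<le> (\<integral>x. norm (indicat_real {p<..<q} x *\<^sub>R U x) \<partial>lebesgue)"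
      by (metis integral_norm_bound)
    also have "\<dots> \<le> (\<integral>x. indicat_real {p<..<q} x * \<phi> x + n * indicat_real {p<..<q} x \<partial>lebesgue)"
    proof (rule integral_mono)
      show "integrable lebesgue (\<lambda>x. norm (indicat_real {p<..<q} x *\<^sub>R U x))"
        using integrable_norm[OF integrable_mult_indicator[OF _ U, of "{p<..<q}"]] by simp
      have "integrable lebesgue (\<lambda>x. real n * indicat_real {p<..<q} x)"
        using that by (intro integrable_mult_right) (simp add: integrable_indicator_iff)
      then show "integrable lebesgue (\<lambda>x. indicat_real {p<..<q} x * \<phi> x + n * indicat_real {p<..<q} x)"
        using ind[OF \<phi>] by (intro Bochner_Integration.integrable_add)
      show "norm (indicat_real {p<..<q} x *\<^sub>R U x) \<le> indicat_real {p<..<q} x * \<phi> x + n * indicat_real {p<..<q} x" for x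
        by (auto simp: \<phi>_def indicator_def)
    qed
    also have "\<dots> = (\<integral>x. indicat_real {p<..<q} x * \<phi> x \<partial>lebesgue) + real n * (q - p)"
      using ind[OF \<phi>] \<open>p \<le> q\<close> by (subst Bochner_Integration.integral_add) (auto simp: integrable_indicator_iff)
    finally show ?thesis .
  qed
  show "\<exists>\<delta>>0. \<forall>D. finite D \<longrightarrow> (\<forall>(p, q)\<in>D. a \<le> p \<and> p \<le> q \<and> q \<le> b) \<longrightarrow>
          disjoint_family_on (\<lambda>(p, q). {p<..<q}) D \<longrightarrow> (\<Sum>(p, q)\<in>D. q - p) < \<delta> \<longrightarrow>
          (\<Sum>(p, q)\<in>D. norm (prim u q - prim u p)) < \<epsilon>"
  \<comment> \<open>The bounded part then costs at most half of \<epsilon>; \<open>n + 1\<close>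
    instead of \<open>n\<close> keeps the quotient meaningful for \<open>n = 0\<close>.\<close>
  proof (intro exI[of _ "\<epsilon> / (2 * (real n + 1))"] conjI allI impI)
    show "0 < \<epsilon> / (2 * (real n + 1))" using e by simp
  next
    fix D :: "(real \<times> real) set"
    assume fin: "finite D" and D: "\<forall>(p, q)\<in>D. a \<le> p \<and> p \<le> q \<and> q \<le> b"
      and disj: "disjoint_family_on (\<lambda>(p, q). {p<..<q}) D"
      and small: "(\<Sum>(p, q)\<in>D. q - p) < \<epsilon> / (2 * (real n + 1))"
    \<comment> \<open>Disjointness enters here: each point is counted at most once, so the integrals
      of \<open>\<phi>\<close> over the intervals add up to at most its full integral.\<close>
    have le1: "(\<Sum>(p, q)\<in>D. indicat_real {p<..<q} x) \<le> 1" for x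
    proof (cases "\<exists>z\<in>D. x \<in> (case z of (p, q) \<Rightarrow> {p<..<q})")
      case True
      then obtain z where "z \<in> D" "x \<in> (case z of (p, q) \<Rightarrow> {p<..<q})" by blast
      from sum_indicator_disjoint_family[OF disj this(2) fin this(1), of "\<lambda>_. 1 :: real"]
      show ?thesis by (simp add: case_prod_unfold)
    next
      case False
      then have "(\<Sum>(p, q)\<in>D. indicat_real {p<..<q} x) = 0"
        by (intro sum.neutral) (auto simp: indicator_def)
      then show ?thesis by simp
    qed
    have "(\<Sum>(p, q)\<in>D. norm (prim u q - prim u p)) \<le>
        (\<Sum>(p, q)\<in>D. (\<integral>x. indicat_real {p<..<q} x * \<phi> x \<partial>lebesgue) + real n * (q - p))"
      using D step by (intro sum_mono) auto
    also have "\<dots> = (\<Sum>(p, q)\<in>D. (\<integral>x. indicat_real {p<..<q} x * \<phi> x \<partial>lebesgue)) + n * (\<Sum>(p, q)\<in>D. (q - p))"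
      by (simp add: sum.distrib sum_distrib_left case_prod_unfold)
    also have "(\<Sum>(p, q)\<in>D. (\<integral>x. indicat_real {p<..<q} x * \<phi> x \<partial>lebesgue)) =
        (\<integral>x. (\<Sum>(p, q)\<in>D. indicat_real {p<..<q} x * \<phi> x) \<partial>lebesgue)"
      using ind[OF \<phi>] by (simp add: case_prod_unfold)
    also have "\<dots> \<le> (\<integral>x. \<phi> x \<partial>lebesgue)"
    proof (rule integral_mono)
      show "integrable lebesgue (\<lambda>x. \<Sum>(p, q)\<in>D. indicat_real {p<..<q} x * \<phi> x)"
        using ind[OF \<phi>] by (auto simp: case_prod_unfold)
      show "(\<Sum>(p, q)\<in>D. indicat_real {p<..<q} x * \<phi> x) \<le> \<phi> x" for x
        using mult_right_mono[OF le1 \<phi>0, of x x] by (simp add: sum_distrib_right case_prod_unfold)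
    qed (rule \<phi>)
    also have "\<dots> < \<epsilon> / 2" using n by (simp add: \<phi>_def)
    also have "n * (\<Sum>(p, q)\<in>D. (q - p)) \<le> n * (\<epsilon> / (2 * (real n + 1)))"
      using small by (intro mult_left_mono) auto
    also have "\<dots> \<le> \<epsilon> / 2" using e by (simp add: field_simps)
    finally show "(\<Sum>(p, q)\<in>D. norm (prim u q - prim u p)) < \<epsilon>" by simp
  qed
qed

text \<open>
  Tagged division argument: the intervals tagged outside the exceptional null set \<open>N\<close> contribute little by
  the derivative, those tagged in \<open>N\<close> lie in an open set of small measure and contribute little by
  absolute continuity.
\<close>

lemma abs_continuous_on_zero_derivative:
  assumes ac: "abs_continuous_on F a b" and ab: "a \<le> b"
    and der: "AE x in lebesgue. (F has_vector_derivative 0) (at x)"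
  shows "F b = F a"
proof -
  have "norm (F b - F a) \<le> 0 + e" if "0 < e" for e
  proof -
    \<comment> \<open>The slope is chosen so that the whole interval costs at most
      \<open>e / 2\<close>; the summand 1 avoids division by zero when \<open>a = b\<close>.\<close>
    define e' where "e' = e / (2 * (b - a + 1))"
    have e': "0 < e'" "e' * (b - a) \<le> e / 2" using that ab by (auto simp: e'_def field_simps)
    obtain \<delta> where \<delta>: "0 < \<delta>" and acD: "\<And>D. finite D \<Longrightarrow> (\<And>p q. (p, q) \<in> D \<Longrightarrow> a \<le> p \<and> p \<le> q \<and> q \<le> b) \<Longrightarrow>
        disjoint_family_on (\<lambda>(p, q). {p<..<q}) D \<Longrightarrow> (\<Sum>(p, q)\<in>D. q - p) < \<delta> \<Longrightarrow>
        (\<Sum>(p, q)\<in>D. norm (F q - F p)) < e / 2"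
    proof -
      have "0 < e / 2" using \<open>0 < e\<close> by simp
      from ac[unfolded abs_continuous_on_def, rule_format, OF this] show ?thesis
        by (elim exE conjE) (rule that, blast+)
    qed
    obtain N where N: "N \<in> null_sets lebesgue" and Nd: "\<And>x. x \<notin> N \<Longrightarrow> (F has_vector_derivative 0) (at x)"
    proof (rule AE_E3[OF der])
      fix N assume "\<And>x. x \<in> space lebesgue - N \<Longrightarrow> (F has_vector_derivative 0) (at x)" "N \<in> null_sets lebesgue"
      then show ?thesis using that by simp
    qed
    obtain T where T: "open T" "N \<subseteq> T" "T - N \<in> lmeasurable" "emeasure lebesgue (T - N) < ennreal \<delta>"
      using sets_lebesgue_outer_open[of N \<delta>] N \<delta> by auto
    have Tsets: "T \<in> sets lebesgue" using T(1) by simp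
    \<comment> \<open>The outer approximation bounds only the excess \<open>T - N\<close>; since
      \<open>N\<close> is null, the same bound holds for \<open>T\<close>.\<close>
    have "emeasure lebesgue T = emeasure lebesgue (T - N)"
      using emeasure_Diff_null_set[OF N Tsets] by simp
    with T have emT: "emeasure lebesgue T < ennreal \<delta>" by simp
    have Tm: "T \<in> lmeasurable"
      using emT Tsets by (intro fmeasurableI) (auto intro: less_trans)
    have mT: "measure lebesgue T < \<delta>"
      using emT \<delta> Tm by (simp add: emeasure_eq_measure2 ennreal_less_iff)
    have "\<exists>d>0. (x \<in> N \<longrightarrow> ball x d \<subseteq> T) \<and> (x \<notin> N \<longrightarrow> (\<forall>y. norm (y - x) < d \<longrightarrow> norm (F y - F x) \<le> e' * norm (y - x)))" for x
    proof (cases "x \<in> N")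
      case True
      then show ?thesis using T openE[OF T(1), of x] by blast
    next
      case False
      from Nd[OF this] show ?thesis
        unfolding has_vector_derivative_def has_derivative_at_alt using e' False by auto
    qed
    then obtain d where d: "\<And>x. 0 < d x" "\<And>x. x \<in> N \<Longrightarrow> ball x (d x) \<subseteq> T"
      "\<And>x y. x \<notin> N \<Longrightarrow> norm (y - x) < d x \<Longrightarrow> norm (F y - F x) \<le> e' * norm (y - x)"
      by metis
    have "gauge (\<lambda>x. ball x (d x))" using d(1) by (auto simp: gauge_def)
    then obtain p where p: "p tagged_division_of {a..b}" and fine: "(\<lambda>x. ball x (d x)) fine p"
      by (rule fine_division_exists_real)
    note pD = tagged_division_ofD[OF p]
    have mem: "Inf K \<le> x \<and> x \<le> Sup K \<and> a \<le> Inf K \<and> Sup K \<le> b \<and> K = {Inf K..Sup K} \<and> K \<subseteq> ball x (d x)"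
      if xK: "(x, K) \<in> p" for x K
    proof -
      obtain l r where K: "K = cbox l r" using pD(4)[OF xK] by blast
      with pD(2)[OF xK] pD(3)[OF xK] have "l \<le> x" "x \<le> r" "a \<le> l" "r \<le> b" by auto
      with K show ?thesis using fineD[OF fine xK] by simp
    qed
    define p1 where "p1 = {z \<in> p. fst z \<in> N}"
    define p2 where "p2 = {z \<in> p. fst z \<notin> N}"
    have fin: "finite p1" "finite p2" using pD(1) by (auto simp: p1_def p2_def)
    let ?n = "\<lambda>(x::real, K). norm (F (Sup K) - F (Inf K))"
    let ?h = "\<lambda>(x::real, K::real set). (Inf K, Sup K)"
    have "F b - F a = (\<Sum>(x, K)\<in>p. F (Sup K) - F (Inf K))"
      using additive_tagged_division_1[OF ab p, of F] by simp
    then have "norm (F b - F a) \<le> (\<Sum>z\<in>p. ?n z)"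
      by (simp add: sum_norm_le case_prod_unfold)
    also have "\<dots> = (\<Sum>z\<in>p1. ?n z) + (\<Sum>z\<in>p2. ?n z)"
      using pD(1) by (subst sum.union_disjoint[symmetric]) (auto simp: p1_def p2_def intro!: sum.cong)
    also have "(\<Sum>z\<in>p2. ?n z) \<le> (\<Sum>(x,K)\<in>p2. e' * (Sup K - Inf K))"
    proof (rule sum_mono, safe)
      fix x K assume z: "(x, K) \<in> p2"
      then have xK: "(x, K) \<in> p" "x \<notin> N" by (auto simp: p2_def)
      note m = mem[OF xK(1)]
      have "{Inf K, Sup K} \<subseteq> K" using m by (metis atLeastAtMost_iff empty_subsetI insert_subset order_refl order_trans)
      then have "Inf K \<in> ball x (d x)" "Sup K \<in> ball x (d x)" using m by blast+
      then have "norm (F (Sup K) - F x) \<le> e' * norm (Sup K - x)" "norm (F (Inf K) - F x) \<le> e' * norm (Inf K - x)"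
        by (intro d(3)[OF xK(2)]; simp add: dist_norm abs_minus_commute)+
      \<comment> \<open>Straddling: the tag \<open>x\<close> lies between the end points, so the two
        distances from \<open>x\<close> add up to exactly the length of \<open>K\<close>.\<close>
      moreover have "norm (F (Sup K) - F (Inf K)) \<le> norm (F (Sup K) - F x) + norm (F (Inf K) - F x)"
        using norm_triangle_ineq4[of "F (Sup K) - F x" "F (Inf K) - F x"] by simp
      ultimately have "norm (F (Sup K) - F (Inf K)) \<le> e' * norm (Sup K - x) + e' * norm (Inf K - x)" by linarith
      also have "\<dots> = e' * (Sup K - Inf K)" using m by (simp add: algebra_simps)
      finally show "norm (F (Sup K) - F (Inf K)) \<le> e' * (Sup K - Inf K)" .
    qed
    also have "\<dots> \<le> (\<Sum>(x,K)\<in>p. e' * (Sup K - Inf K))"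
    proof (rule sum_mono2)
      fix z assume "z \<in> p - p2"
      then have "Inf (snd z) \<le> Sup (snd z)" using mem[of "fst z" "snd z"] by auto
      then show "0 \<le> (case z of (x, K) \<Rightarrow> e' * (Sup K - Inf K))"
        using e' by (simp add: case_prod_unfold)
    qed (use pD(1) in \<open>auto simp: p2_def\<close>)
    also have "\<dots> = e' * (b - a)"
      using additive_tagged_division_1[OF ab p, of "\<lambda>x. x"] by (simp add: case_prod_unfold flip: sum_distrib_left)
    also have "\<dots> \<le> e / 2" by (rule e')
    also have "(\<Sum>z\<in>p1. ?n z) < e / 2"
    proof -
      \<comment> \<open>Absolute continuity speaks of a set of end point pairs, while a tagged
        division may contain the same degenerate interval with several tags or end points. Only
        degenerate intervals can collide, and their increments are zero, so the sum survives the
        reindexing.\<close>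
      have same: "Inf K = Sup K" if "(x, K) \<in> p1" "(y, L) \<in> p1" "(x, K) \<noteq> (y, L)" "?h (x, K) = ?h (y, L)" for x y K L
      proof -
        have xK: "(x, K) \<in> p" "(y, L) \<in> p" using that by (auto simp: p1_def)
        have "K = L" using mem[OF xK(1)] mem[OF xK(2)] that(4) by (metis prod.inject split_conv)
        then have "interior K = {}" using pD(5)[OF xK that(3)] by simp
        then have "{Inf K<..<Sup K} = {}" using mem[OF xK(1)] by (metis interior_atLeastAtMost_real)
        then show ?thesis using mem[OF xK(1)] by (simp add: greaterThanLessThan_empty_iff)
      qed
      let ?D = "?h ` p1"
      have eq: "(\<Sum>z\<in>p1. ?n z) = (\<Sum>(p, q)\<in>?D. norm (F q - F p))"
        by (subst sum.reindex_nontrivial[OF fin(1)]) (use same in \<open>fastforce simp: case_prod_unfold\<close>)+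
      have disj: "disjoint_family_on (\<lambda>(p, q). {p<..<q}) ?D"
        unfolding disjoint_family_on_def
      proof (intro ballI impI)
        fix z w assume "z \<in> ?D" "w \<in> ?D" and ne: "z \<noteq> w"
        then obtain x K y L where 1: "(x, K) \<in> p1" "z = ?h (x, K)" "(y, L) \<in> p1" "w = ?h (y, L)" by fast
        then have xK: "(x, K) \<in> p" "(y, L) \<in> p" by (auto simp: p1_def)
        have "interior K \<inter> interior L = {}" using pD(5)[OF xK] 1 ne by blast
        then show "(case z of (p, q) \<Rightarrow> {p<..<q}) \<inter> (case w of (p, q) \<Rightarrow> {p<..<q}) = {}"
          using mem[OF xK(1)] mem[OF xK(2)] 1 by (metis interior_atLeastAtMost_real split_conv)
      qed
      have bd: "a \<le> l \<and> l \<le> r \<and> r \<le> b" if lr: "(l, r) \<in> ?D" for l r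
      proof -
        obtain x K where "(x, K) \<in> p" "l = Inf K" "r = Sup K" using lr by (auto simp: p1_def)
        then show ?thesis using mem[of x K] by auto
      qed
      have "(\<Sum>(p, q)\<in>?D. q - p) = (\<Sum>z\<in>?D. measure lebesgue (case z of (p, q) \<Rightarrow> {p<..<q}))"
      proof (rule sum.cong[OF refl])
        fix z assume "z \<in> ?D"
        then have "fst z \<le> snd z" using bd[of "fst z" "snd z"] by simp
        then show "(case z of (p, q) \<Rightarrow> q - p) = measure lebesgue (case z of (p, q) \<Rightarrow> {p<..<q})"
          by (simp add: case_prod_unfold)
      qed
      also have "\<dots> = measure lebesgue (\<Union>z\<in>?D. case z of (p, q) \<Rightarrow> {p<..<q})"
        using fin(1) disj emeasure_bounded_finite[OF bounded_Ioo]
        by (intro measure_finite_Union[symmetric]) (auto simp: case_prod_unfold less_top[symmetric])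
      also have "\<dots> \<le> measure lebesgue T"
      proof (rule measure_mono_fmeasurable[OF _ _ Tm])
        show "(\<Union>z\<in>?D. case z of (p, q) \<Rightarrow> {p<..<q}) \<subseteq> T"
        proof (clarsimp)
          fix y x K assume z: "(x, K) \<in> p1" "Inf K < y" "y < Sup K"
          then have xK: "(x, K) \<in> p" "x \<in> N" by (auto simp: p1_def)
          have "y \<in> {Inf K..Sup K}" using z by auto
          then show "y \<in> T" using mem[OF xK(1)] d(2)[OF xK(2)] by blast
        qed
        show "(\<Union>z\<in>?D. case z of (p, q) \<Rightarrow> {p<..<q}) \<in> sets lebesgue"
          using fin(1) by (intro sets.finite_UN) (auto simp: case_prod_unfold)
      qed
      also note mT
      finally show ?thesis unfolding eq using acD[of ?D] fin(1) bd disj by blast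
    qed
    finally show ?thesis by simp
  qed
  then have "norm (F b - F a) \<le> 0" by (rule field_le_epsilon)
  then show ?thesis by simp
qed

text \<open>The common mechanism behind the closure properties: an increment bound on subintervals
  transfers absolute continuity from two functions to a third. Giving each of them
  \<open>\<epsilon> / (2 * M)\<close> makes the total come out as \<epsilon>.\<close>

lemma abs_continuous_on_dominated:
  assumes F: "abs_continuous_on F a b" and G: "abs_continuous_on G a b" and M: "0 < M"
    and le: "\<And>p q. a \<le> p \<Longrightarrow> p \<le> q \<Longrightarrow> q \<le> b \<Longrightarrow>
      norm (H q - H p) \<le> M * (norm (F q - F p) + norm (G q - G p))"
  shows "abs_continuous_on H a b"
  unfolding abs_continuous_on_def
proof (intro allI impI)
  fix \<epsilon> :: real assume "0 < \<epsilon>"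
  then have e: "0 < \<epsilon> / (2 * M)" using M by simp
  obtain d1 where d1: "0 < d1" and D1: "\<And>D. finite D \<Longrightarrow> \<forall>(p, q)\<in>D. a \<le> p \<and> p \<le> q \<and> q \<le> b \<Longrightarrow>
      disjoint_family_on (\<lambda>(p, q). {p<..<q}) D \<Longrightarrow> (\<Sum>(p, q)\<in>D. q - p) < d1 \<Longrightarrow>
      (\<Sum>(p, q)\<in>D. norm (F q - F p)) < \<epsilon> / (2 * M)"
    using F[unfolded abs_continuous_on_def, rule_format, OF e] by (elim exE conjE) (rule that, blast+)
  obtain d2 where d2: "0 < d2" and D2: "\<And>D. finite D \<Longrightarrow> \<forall>(p, q)\<in>D. a \<le> p \<and> p \<le> q \<and> q \<le> b \<Longrightarrow>
      disjoint_family_on (\<lambda>(p, q). {p<..<q}) D \<Longrightarrow> (\<Sum>(p, q)\<in>D. q - p) < d2 \<Longrightarrow>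
      (\<Sum>(p, q)\<in>D. norm (G q - G p)) < \<epsilon> / (2 * M)"
    using G[unfolded abs_continuous_on_def, rule_format, OF e] by (elim exE conjE) (rule that, blast+)
  show "\<exists>\<delta>>0. \<forall>D. finite D \<longrightarrow> (\<forall>(p, q)\<in>D. a \<le> p \<and> p \<le> q \<and> q \<le> b) \<longrightarrow>
          disjoint_family_on (\<lambda>(p, q). {p<..<q}) D \<longrightarrow> (\<Sum>(p, q)\<in>D. q - p) < \<delta> \<longrightarrow>
          (\<Sum>(p, q)\<in>D. norm (H q - H p)) < \<epsilon>"
  proof (intro exI[of _ "min d1 d2"] conjI allI impI)
    show "0 < min d1 d2" using d1 d2 by simp
  next
    fix D :: "(real \<times> real) set"
    assume D: "finite D" "\<forall>(p, q)\<in>D. a \<le> p \<and> p \<le> q \<and> q \<le> b"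
      "disjoint_family_on (\<lambda>(p, q). {p<..<q}) D" "(\<Sum>(p, q)\<in>D. q - p) < min d1 d2"
    have "(\<Sum>(p, q)\<in>D. norm (H q - H p)) \<le> (\<Sum>(p, q)\<in>D. M * (norm (F q - F p) + norm (G q - G p)))"
      using D(2) le by (intro sum_mono) auto
    also have "\<dots> = M * ((\<Sum>(p, q)\<in>D. norm (F q - F p)) + (\<Sum>(p, q)\<in>D. norm (G q - G p)))"
      by (simp add: sum.distrib sum_distrib_left case_prod_unfold distrib_left)
    also have "\<dots> < M * (\<epsilon> / (2 * M) + \<epsilon> / (2 * M))"
      using M D1[OF D(1-3)] D2[OF D(1-3)] D(4) by (intro mult_strict_left_mono add_strict_mono) auto
    also have "\<dots> = \<epsilon>" using M by (simp add: field_simps)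
    finally show "(\<Sum>(p, q)\<in>D. norm (H q - H p)) < \<epsilon>" .
  qed
qed

section \<open>Continuity and closure properties of absolutely continuous functions\<close>

lemma abs_continuous_on_imp_continuous_on:
  assumes "abs_continuous_on F a b" shows "continuous_on {a..b} F"
  unfolding continuous_on_iff
proof (intro ballI allI impI)
  fix x e :: real assume x: "x \<in> {a..b}" and e: "0 < e"
  obtain d where d: "0 < d" and D: "\<And>D. finite D \<Longrightarrow> \<forall>(p, q)\<in>D. a \<le> p \<and> p \<le> q \<and> q \<le> b \<Longrightarrow>
      disjoint_family_on (\<lambda>(p, q). {p<..<q}) D \<Longrightarrow> (\<Sum>(p, q)\<in>D. q - p) < d \<Longrightarrow>
      (\<Sum>(p, q)\<in>D. norm (F q - F p)) < e"
    using assms[unfolded abs_continuous_on_def, rule_format, OF e] by (elim exE conjE) (rule that, blast+)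
  have step: "norm (F q - F p) < e" if "a \<le> p" "p \<le> q" "q \<le> b" "q - p < d" for p q
    using D[of "{(p, q)}"] that by (simp add: disjoint_family_on_def)
  show "\<exists>d>0. \<forall>y\<in>{a..b}. dist y x < d \<longrightarrow> dist (F y) (F x) < e"
  proof (intro exI[of _ d] conjI ballI impI d)
    fix y assume y: "y \<in> {a..b}" "dist y x < d"
    show "dist (F y) (F x) < e"
    proof (cases "x \<le> y")
      case True
      then show ?thesis using step[of x y] x y by (simp add: dist_norm)
    next
      case False
      then have "norm (F x - F y) < e" using step[of y x] x y by (simp add: dist_norm)
      then show ?thesis by (simp add: dist_norm norm_minus_commute)
    qed
  qed
qed

lemma locally_abs_continuous_continuous:
  assumes "locally_abs_continuous F" shows "continuous_on UNIV F"
proof -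
  have "isCont F x" for x
  proof -
    have "continuous_on {x - 1..x + 1} F"
      using assms by (intro abs_continuous_on_imp_continuous_on) (simp add: locally_abs_continuous_def)
    then show ?thesis by (rule continuous_on_interior) simp
  qed
  then show ?thesis by (simp add: continuous_on_eq_continuous_at)
qed

lemma locally_abs_continuous_bounded:
  assumes "locally_abs_continuous F"
  obtains M where "0 < M" "\<And>x. x \<in> {a..b} \<Longrightarrow> norm (F x) \<le> M"
proof -
  have "compact (F ` {a..b})"
    using locally_abs_continuous_continuous[OF assms] continuous_on_subset
    by (intro compact_continuous_image) auto
  then show ?thesis using that compact_imp_bounded[of "F ` {a..b}"] by (auto simp: bounded_pos)
qed

lemma locally_abs_continuous_const: "locally_abs_continuous (\<lambda>x. c)"
  by (auto simp: locally_abs_continuous_def abs_continuous_on_def case_prod_unfold intro: exI[of _ 1])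

lemma locally_abs_continuous_diff:
  assumes "locally_abs_continuous F" "locally_abs_continuous G"
  shows "locally_abs_continuous (\<lambda>x. F x - G x)"
  unfolding locally_abs_continuous_def
proof (intro allI impI)
  fix a b :: real assume "a \<le> b"
  then have *: "abs_continuous_on F a b" "abs_continuous_on G a b"
    using assms by (auto simp: locally_abs_continuous_def)
  show "abs_continuous_on (\<lambda>x. F x - G x) a b"
  proof (rule abs_continuous_on_dominated[OF *, of 1])
    fix p q
    show "norm (F q - G q - (F p - G p)) \<le> 1 * (norm (F q - F p) + norm (G q - G p))"
      using norm_triangle_ineq4[of "F q - F p" "G q - G p"] by (simp add: algebra_simps)
  qed simp
qed

lemma locally_abs_continuous_mult:
  assumes "locally_abs_continuous F" "locally_abs_continuous G"
  shows "locally_abs_continuous (\<lambda>x. F x * G x)"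
  unfolding locally_abs_continuous_def
proof (intro allI impI)
  fix a b :: real assume "a \<le> b"
  then have *: "abs_continuous_on F a b" "abs_continuous_on G a b"
    using assms by (auto simp: locally_abs_continuous_def)
  obtain M where M: "0 < M" "\<And>x. x \<in> {a..b} \<Longrightarrow> norm (F x) \<le> M"
    using locally_abs_continuous_bounded[OF assms(1)] by blast
  obtain N where N: "0 < N" "\<And>x. x \<in> {a..b} \<Longrightarrow> norm (G x) \<le> N"
    using locally_abs_continuous_bounded[OF assms(2)] by blast
  show "abs_continuous_on (\<lambda>x. F x * G x) a b"
  proof (rule abs_continuous_on_dominated[OF *])
    show "0 < max M N" using M by simp
    fix p q assume pq: "a \<le> p" "p \<le> q" "q \<le> b"
    have "F q * G q - F p * G p = (F q - F p) * G q + F p * (G q - G p)" by (simp add: algebra_simps)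
    then have "norm (F q * G q - F p * G p) \<le> norm (F q - F p) * norm (G q) + norm (F p) * norm (G q - G p)"
      using norm_triangle_ineq[of "(F q - F p) * G q" "F p * (G q - G p)"] by (simp add: norm_mult)
    also have "\<dots> \<le> norm (F q - F p) * max M N + max M N * norm (G q - G p)"
      using M(1) M(2)[of p] N(1) N(2)[of q] pq by (intro add_mono mult_mono) (auto simp: max_def)
    finally show "norm (F q * G q - F p * G p) \<le> max M N * (norm (F q - F p) + norm (G q - G p))"
      by (simp add: algebra_simps)
  qed
qed

text \<open>On a compact interval the values of \<open>F\<close> stay in a disc of radius
  \<open>M\<close>. The disc is convex and the derivative of \<open>exp\<close> there is at most
  \<open>exp M\<close>, so \<open>exp\<close> is Lipschitz on it.\<close>

lemma locally_abs_continuous_exp: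
  assumes "locally_abs_continuous F" shows "locally_abs_continuous (\<lambda>x. exp (F x))"
  unfolding locally_abs_continuous_def
proof (intro allI impI)
  fix a b :: real assume "a \<le> b"
  then have *: "abs_continuous_on F a b"
    using assms by (auto simp: locally_abs_continuous_def)
  obtain M where M: "0 < M" "\<And>x. x \<in> {a..b} \<Longrightarrow> norm (F x) \<le> M"
    using locally_abs_continuous_bounded[OF assms(1)] by blast
  show "abs_continuous_on (\<lambda>x. exp (F x)) a b"
  proof (rule abs_continuous_on_dominated[OF * *])
    fix p q assume pq: "a \<le> p" "p \<le> q" "q \<le> b"
    have "norm (exp (F q) - exp (F p)) \<le> exp M * norm (F q - F p)"
    proof (rule field_differentiable_bound[of "cball 0 M" exp exp])
      fix z :: complex assume "z \<in> cball 0 M"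
      then show "norm (exp z) \<le> exp M"
        using norm_exp[of z] by (auto intro: order_trans)
    qed (use M pq in \<open>auto intro: DERIV_exp[THEN has_field_derivative_at_within]\<close>)
    also have "\<dots> \<le> exp M * (norm (F q - F p) + norm (F q - F p))" by simp
    finally show "norm (exp (F q) - exp (F p)) \<le> exp M * (norm (F q - F p) + norm (F q - F p))" .
  qed simp
qed

text \<open>The Caratheodory sense of \<open>F' = h\<close>. The derivative \<open>h\<close> is a
  separate argument, so the rules below compute derivatives syntactically, and \<open>F\<close> is
  determined by \<open>h\<close> up to a constant.\<close>

definition ac_deriv :: "(real \<Rightarrow> complex) \<Rightarrow> (real \<Rightarrow> complex) \<Rightarrow> bool" where
  "ac_deriv F h \<longleftrightarrow> locally_abs_continuous F \<and> (AE x in lebesgue. (F has_vector_derivative h x) (at x))"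

lemma ac_deriv_prim: "u \<in> L1_loc \<Longrightarrow> ac_deriv (prim u) u"
  by (simp add: ac_deriv_def locally_abs_continuous_def abs_continuous_on_prim AE_prim_has_vector_derivative)

lemma ac_deriv_const: "ac_deriv (\<lambda>x. c) (\<lambda>x. 0)"
  by (simp add: ac_deriv_def locally_abs_continuous_const)

lemma ac_deriv_diff:
  assumes "ac_deriv F h" "ac_deriv G k"
  shows "ac_deriv (\<lambda>x. F x - G x) (\<lambda>x. h x - k x)"
proof -
  have "AE x in lebesgue. (F has_vector_derivative h x) (at x)"
    "AE x in lebesgue. (G has_vector_derivative k x) (at x)" using assms by (auto simp add: ac_deriv_def)
  then have "AE x in lebesgue. ((\<lambda>x. F x - G x) has_vector_derivative h x - k x) (at x)"
    by eventually_elim (rule has_vector_derivative_diff)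
  then show ?thesis using assms by (simp add: ac_deriv_def locally_abs_continuous_diff)
qed

lemma ac_deriv_mult:
  assumes "ac_deriv F h" "ac_deriv G k"
  shows "ac_deriv (\<lambda>x. F x * G x) (\<lambda>x. F x * k x + h x * G x)"
proof -
  have "AE x in lebesgue. (F has_vector_derivative h x) (at x)"
    "AE x in lebesgue. (G has_vector_derivative k x) (at x)" using assms by (auto simp add: ac_deriv_def)
  then have "AE x in lebesgue. ((\<lambda>x. F x * G x) has_vector_derivative F x * k x + h x * G x) (at x)"
    by eventually_elim (rule has_vector_derivative_mult)
  then show ?thesis using assms by (simp add: ac_deriv_def locally_abs_continuous_mult)
qed

lemma ac_deriv_cmult:
  assumes "ac_deriv F h" shows "ac_deriv (\<lambda>x. c * F x) (\<lambda>x. c * h x)"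
  using ac_deriv_mult[OF ac_deriv_const assms, of c] by simp

lemma ac_deriv_add:
  assumes "ac_deriv F h" "ac_deriv G k"
  shows "ac_deriv (\<lambda>x. F x + G x) (\<lambda>x. h x + k x)"
  using ac_deriv_diff[OF assms(1) ac_deriv_cmult[OF assms(2), of "- 1"]] by simp

lemma ac_deriv_exp:
  assumes "ac_deriv F h" shows "ac_deriv (\<lambda>x. exp (F x)) (\<lambda>x. h x * exp (F x))"
proof -
  have "AE x in lebesgue. (F has_vector_derivative h x) (at x)" using assms by (simp add: ac_deriv_def)
  then have "AE x in lebesgue. ((\<lambda>x. exp (F x)) has_vector_derivative h x * exp (F x)) (at x)"
  proof eventually_elim
    case (elim x)
    show ?case using field_vector_diff_chain_at[OF elim DERIV_exp] by (simp add: o_def)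
  qed
  then show ?thesis using assms by (simp add: ac_deriv_def locally_abs_continuous_exp)
qed

lemma ac_deriv_power:
  assumes "ac_deriv F h" shows "ac_deriv (\<lambda>x. F x ^ n) (\<lambda>x. of_nat n * F x ^ (n - 1) * h x)"
proof (induction n)
  case 0
  then show ?case using ac_deriv_const[of 1] by simp
next
  case (Suc n)
  \<comment> \<open>The case split on \<open>n\<close> is due to truncated subtraction:
    \<open>F x * F x ^ (n - 1)\<close> is \<open>F x ^ n\<close> only for positive \<open>n\<close>,
    and for \<open>n = 0\<close> the factor \<open>of_nat n\<close> removes the term.\<close>
  show ?case
    by (rule back_subst[of "ac_deriv (\<lambda>x. F x ^ Suc n)"], use ac_deriv_mult[OF assms Suc] in simp)
      (cases n, auto simp: fun_eq_iff algebra_simps)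
qed

lemma ac_deriv_zero_constant:
  assumes "ac_deriv F (\<lambda>x. 0)" shows "F x = F y"
proof (rule linorder_wlog[of "\<lambda>x y. F x = F y"])
  fix a b :: real assume "a \<le> b"
  then show "F a = F b"
    using abs_continuous_on_zero_derivative[of F a b] assms
    by (auto simp: ac_deriv_def locally_abs_continuous_def)
qed simp

lemma ac_deriv_unique:
  assumes "ac_deriv F h" "ac_deriv G h" "F 0 = G 0" shows "F x = G x"
  using ac_deriv_zero_constant[of "\<lambda>x. F x - G x" x 0] ac_deriv_diff[OF assms(1,2)] assms(3) by simp

lemma ac_deriv_continuous: "ac_deriv F h \<Longrightarrow> continuous_on UNIV F"
  by (simp add: ac_deriv_def locally_abs_continuous_continuous)

section \<open>Alternating iterated primitives\<close>

text \<open>Lets identities between primitives be checked by differentiation and evaluation at 0,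
  without treating the two half lines separately.\<close>

lemma prim_eqI:
  assumes "ac_deriv F h" "h \<in> L1_loc" "F 0 = 0" shows "prim h x = F x"
  using ac_deriv_unique[OF ac_deriv_prim[OF assms(2)] assms(1)] assms(3) by simp

lemma prim_zero: "prim (\<lambda>t. 0) x = 0"
  by (rule prim_eqI[OF ac_deriv_const[of 0]]) (auto intro: L1_loc_continuous continuous_on_const)

lemma prim_cmult: "u \<in> L1_loc \<Longrightarrow> prim (\<lambda>t. c * u t) x = c * prim u x"
  by (rule prim_eqI[OF ac_deriv_cmult]) (auto intro: ac_deriv_prim L1_loc_cmult)

lemma prim_add: "u \<in> L1_loc \<Longrightarrow> v \<in> L1_loc \<Longrightarrow> prim (\<lambda>t. u t + v t) x = prim u x + prim v x"
  by (rule prim_eqI[OF ac_deriv_add]) (auto intro: ac_deriv_prim L1_loc_add)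

lemma L1_loc_sum: "(\<And>j. j \<in> J \<Longrightarrow> u j \<in> L1_loc) \<Longrightarrow> (\<lambda>t. \<Sum>j\<in>J. u j t) \<in> L1_loc"
  by (induction J rule: infinite_finite_induct)
    (auto intro: L1_loc_add L1_loc_continuous[OF continuous_on_const])

lemma prim_sum:
  "(\<And>j. j \<in> J \<Longrightarrow> u j \<in> L1_loc) \<Longrightarrow> prim (\<lambda>t. \<Sum>j\<in>J. u j t) x = (\<Sum>j\<in>J. prim (u j) x)"
  by (induction J rule: infinite_finite_induct) (simp_all add: prim_zero prim_add L1_loc_sum)

text \<open>A comparison principle for both half lines at once. The unimodular \<open>c\<close>
  rotates a complex majorant of constant phase onto the nonnegative reals, and it disappears again
  when norms are taken after integration.\<close>

lemma norm_prim_le: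
  assumes u: "u \<in> L1_loc" and k: "k \<in> L1_loc" and c: "norm c = 1"
    and le: "\<And>t. min 0 x \<le> t \<Longrightarrow> t \<le> max 0 x \<Longrightarrow> norm (u t) \<le> Re (c * k t)"
  shows "norm (prim u x) \<le> norm (prim k x)"
proof -
  define a b where "a = min 0 x" and "b = max 0 x"
  have ab: "norm (prim w x) = norm (integral {a..b} w)" if "w \<in> L1_loc" for w
    using that by (cases "0 \<le> x") (auto simp: prim_nonneg prim_nonpos a_def b_def min_def max_def)
  have ck: "(\<lambda>t. c * k t) integrable_on {a..b}" using k L1_loc_cmult L1_loc_integrable by blast
  have "norm (integral {a..b} u) \<le> integral {a..b} (\<lambda>t. Re (c * k t))"
  proof (rule integral_norm_bound_integral)
    show "(\<lambda>t. Re (c * k t)) integrable_on {a..b}" 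
      using integrable_linear[OF ck bounded_linear_Re] by (simp add: o_def)
  qed (use le L1_loc_integrable[OF u] in \<open>auto simp: a_def b_def\<close>)
  also have "\<dots> = Re (c * integral {a..b} k)"
    using integral_linear[OF ck bounded_linear_Re] by (simp add: o_def)
  also have "\<dots> \<le> norm (c * integral {a..b} k)" by (rule complex_Re_le_cmod)
  also have "\<dots> = norm (integral {a..b} k)" using c by (simp add: norm_mult)
  finally show ?thesis using ab u k by simp
qed

text \<open>Primitives commute with series that converge uniformly on compact sets, even against an
  unbounded weight \<open>w\<close>: the error is at most the uniform error times the primitive of
  \<open>norm (w t)\<close>.\<close>

lemma prim_sums:
  assumes w: "w \<in> L1_loc" and cont: "\<And>j. continuous_on UNIV (p j)"
    and lim: "\<And>R. uniform_limit {-R..R} (\<lambda>n t. \<Sum>j<n. p j t) q sequentially"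
    and q: "continuous_on UNIV q"
  shows "(\<lambda>j. prim (\<lambda>t. w t * p j t) x) sums prim (\<lambda>t. w t * q t) x"
  unfolding sums_def
proof (rule metric_LIMSEQ_I)
  fix e :: real assume e: "0 < e"
  define W where "W = (\<lambda>t. complex_of_real (norm (w t)))"
  have W: "W \<in> L1_loc" unfolding W_def by (rule L1_loc_norm[OF w])
  define d where "d = e / (norm (prim W x) + 1)"
  have d: "0 < d" using e by (simp add: d_def add_nonneg_pos)
  have L: "(\<lambda>t. w t * f t) \<in> L1_loc" if "continuous_on UNIV f" for f
    using L1_loc_continuous_mult[OF w that] by (simp add: mult.commute)
  obtain N where N: "\<And>n t. N \<le> n \<Longrightarrow> t \<in> {-\<bar>x\<bar>..\<bar>x\<bar>} \<Longrightarrow> dist (\<Sum>j<n. p j t) (q t) < d"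
    using uniform_limitD[OF lim d, of "\<bar>x\<bar>"] unfolding eventually_sequentially by blast
  have "dist (\<Sum>j<n. prim (\<lambda>t. w t * p j t) x) (prim (\<lambda>t. w t * q t) x) < e" if n: "N \<le> n" for n
  proof -
    have c: "continuous_on UNIV (\<lambda>t. (\<Sum>j<n. p j t))"
      by (intro continuous_on_sum cont)
    have Lr: "(\<lambda>t. w t * ((\<Sum>j<n. p j t) - q t)) \<in> L1_loc"
      by (intro L continuous_on_diff c q)
    have "(\<Sum>j<n. prim (\<lambda>t. w t * p j t) x) = prim (\<lambda>t. \<Sum>j<n. w t * p j t) x"
      by (rule prim_sum[symmetric]) (rule L[OF cont])
    also have "\<dots> = prim (\<lambda>t. w t * q t + w t * ((\<Sum>j<n. p j t) - q t)) x"
      by (rule arg_cong[of _ _ "\<lambda>f. prim f x"]) (simp add: fun_eq_iff algebra_simps sum_distrib_left)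
    also have "\<dots> = prim (\<lambda>t. w t * q t) x + prim (\<lambda>t. w t * ((\<Sum>j<n. p j t) - q t)) x"
      by (rule prim_add[OF L[OF q] Lr])
    finally have "dist (\<Sum>j<n. prim (\<lambda>t. w t * p j t) x) (prim (\<lambda>t. w t * q t) x)
        = norm (prim (\<lambda>t. w t * ((\<Sum>j<n. p j t) - q t)) x)" by (simp add: dist_norm)
    also have "\<dots> \<le> norm (prim (\<lambda>t. of_real d * W t) x)"
    proof (rule norm_prim_le[OF Lr L1_loc_cmult[OF W], of 1])
      fix t assume "min 0 x \<le> t" "t \<le> max 0 x"
      then have "t \<in> {-\<bar>x\<bar>..\<bar>x\<bar>}" by auto
      then have "norm ((\<Sum>j<n. p j t) - q t) \<le> d" using N[OF n, of t] by (simp add: dist_norm)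
      then show "norm (w t * ((\<Sum>j<n. p j t) - q t)) \<le> Re (1 * (of_real d * W t))"
        using mult_right_mono[of "norm ((\<Sum>j<n. p j t) - q t)" d "norm (w t)"] by (simp add: W_def norm_mult mult.commute)
    qed simp
    also have "\<dots> = d * norm (prim W x)" using d by (simp add: prim_cmult[OF W] norm_mult)
    also have "\<dots> < e"
      using e by (simp add: d_def pos_divide_less_eq add_nonneg_pos)
    finally show ?thesis .
  qed
  then show "\<exists>no. \<forall>n\<ge>no. dist (\<Sum>j<n. prim (\<lambda>t. w t * p j t) x) (prim (\<lambda>t. w t * q t) x) < e"
    by blast
qed

text \<open>Isolates the recursion from the simplex integrals, so that the analysis of the series
  never sees product measures. Passing from index \<open>j\<close> to \<open>Suc j\<close> adds
  factor number \<open>Suc j\<close>, which is \<open>u\<close> exactly for even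
  \<open>j\<close>.\<close>

locale alternating_iterates =
  fixes u v :: "real \<Rightarrow> complex" and A :: "nat \<Rightarrow> real \<Rightarrow> complex"
  assumes u: "u \<in> L1_loc" and v: "v \<in> L1_loc"
    and A_0: "A 0 x = 1"
    and A_Suc: "A (Suc j) x = prim (\<lambda>s. (if even j then u s else v s) * A j s) x"
begin

text \<open>One majorant \<open>|u| + |v|\<close> serves both parities. It is kept complex valued so
  that the calculus of \<open>prim\<close> applies to it.\<close>

definition "H = prim (\<lambda>t. complex_of_real (norm (u t)) + complex_of_real (norm (v t)))"

lemma L1_loc_uv_mult: "continuous_on UNIV f \<Longrightarrow> (\<lambda>s. (if even (j :: nat) then u s else v s) * f s) \<in> L1_loc"
  using L1_loc_continuous_mult[OF u, of f] L1_loc_continuous_mult[OF v, of f]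
  by (cases "even j") (auto simp: mult.commute)

lemma continuous_A: "continuous_on UNIV (A j)"
proof (induction j)
  case 0
  then show ?case using A_0 by (simp add: continuous_on_const)
next
  case (Suc j)
  have "continuous_on UNIV (prim (\<lambda>s. (if even j then u s else v s) * A j s))"
    by (intro ac_deriv_continuous[OF ac_deriv_prim] L1_loc_uv_mult Suc)
  then show ?case by (simp add: A_Suc[abs_def])
qed

lemma L1_loc_h: "(\<lambda>t. complex_of_real (norm (u t)) + complex_of_real (norm (v t))) \<in> L1_loc"
  by (intro L1_loc_add L1_loc_norm u v)

lemma continuous_H: "continuous_on UNIV H"
  unfolding H_def by (rule ac_deriv_continuous[OF ac_deriv_prim[OF L1_loc_h]])

lemma H_sgn: "H t = (if 0 \<le> t then 1 else - 1) * complex_of_real (norm (H t))"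
proof -
  let ?h = "\<lambda>t. complex_of_real (norm (u t)) + complex_of_real (norm (v t))"
  have *: "integral {a..b} ?h = complex_of_real (norm (integral {a..b} ?h))" for a b
  proof -
    have i: "?h integrable_on {a..b}" using L1_loc_h by (rule L1_loc_integrable)
    have "(\<lambda>t. Re (?h t)) integrable_on {a..b}"
      using integrable_linear[OF i bounded_linear_Re] by (simp add: o_def)
    then have "0 \<le> integral {a..b} (\<lambda>t. Re (?h t))"
      by (rule integral_nonneg) simp
    then have "0 \<le> Re (integral {a..b} ?h)" 
      using integral_linear[OF i bounded_linear_Re] by (simp add: o_def)
    moreover have "Im (integral {a..b} ?h) = 0"
      using integral_linear[OF i bounded_linear_Im] by (simp add: o_def)
    ultimately show ?thesis by (simp add: complex_eq_iff cmod_eq_Re)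
  qed
  show ?thesis
    using prim_nonneg[OF L1_loc_h, of t] prim_nonpos[OF L1_loc_h, of t] *[of 0 t] *[of t 0]
    by (auto simp: H_def)
qed

text \<open>
  \<open>H ^ j\<close> and \<open>norm H ^ j\<close> differ between \<open>0\<close> and \<open>x\<close> by a constant sign only, so that both half lines
  are covered by the single identity that the primitive of \<open>h * H ^ j / fact j\<close> is \<open>H ^ Suc j / fact (Suc j)\<close>.
\<close>

lemma norm_A_le: "norm (A j x) \<le> norm (H x) ^ j / fact j"
proof (induction j arbitrary: x)
  case 0
  then show ?case by (simp add: A_0)
next
  case (Suc j)
  define h where "h = (\<lambda>t. complex_of_real (norm (u t)) + complex_of_real (norm (v t)))"
  define k where "k = (\<lambda>t. H t ^ j / fact j * h t)"
  have k: "k \<in> L1_loc"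
    unfolding k_def h_def using continuous_H
    by (intro L1_loc_continuous_mult L1_loc_h continuous_on_divide continuous_on_power) (auto intro: continuous_on_const)
  have "norm (A (Suc j) x) \<le> norm (prim k x)"
    unfolding A_Suc
  proof (rule norm_prim_le[OF L1_loc_uv_mult[OF continuous_A] k])
    define \<sigma> :: complex where "\<sigma> = (if 0 \<le> x then 1 else - 1)"
    show "norm (\<sigma> ^ j) = 1" by (simp add: \<sigma>_def norm_power)
    fix t assume t: "min 0 x \<le> t" "t \<le> max 0 x"
    have "H t = \<sigma> * complex_of_real (norm (H t))"
    \<comment> \<open>The sign is chosen by \<open>x\<close>, whereas \<open>H_sgn\<close> chooses
      it by \<open>t\<close>. For negative \<open>x\<close> they disagree at \<open>t = 0\<close>,
      where \<open>H\<close> vanishes.\<close>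
    proof (cases "t = 0")
      case False
      then show ?thesis using H_sgn[of t] t by (auto simp: \<sigma>_def min_def max_def split: if_splits)
    qed (simp add: H_def)
    then have "\<sigma> ^ j * H t ^ j = (\<sigma> * \<sigma>) ^ j * complex_of_real (norm (H t)) ^ j"
      by (metis mult.assoc power_mult_distrib)
    also have "\<sigma> * \<sigma> = 1" by (simp add: \<sigma>_def)
    finally have "Re (\<sigma> ^ j * k t) = Re (complex_of_real (norm (H t)) ^ j / fact j * h t)"
      by (simp add: k_def mult.assoc[symmetric])
    also have "complex_of_real (norm (H t)) ^ j / fact j * h t
        = complex_of_real (norm (H t) ^ j / fact j * (norm (u t) + norm (v t)))"
      by (simp add: h_def)
    finally have eq: "Re (\<sigma> ^ j * k t) = (norm (u t) + norm (v t)) * (norm (H t) ^ j / fact j)"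
      by (simp only: Re_complex_of_real mult.commute)
    show "norm ((if even j then u t else v t) * A j t) \<le> Re (\<sigma> ^ j * k t)"
      unfolding eq norm_mult by (intro mult_mono Suc) auto
  qed
  also have "prim k x = H x ^ Suc j / fact (Suc j)"
  proof (rule prim_eqI[OF _ k])
    have "ac_deriv H h" unfolding H_def h_def by (rule ac_deriv_prim[OF L1_loc_h])
    from ac_deriv_cmult[OF ac_deriv_power[OF this, of "Suc j"], of "1 / fact (Suc j)"]
    have "ac_deriv (\<lambda>x. H x ^ Suc j / fact (Suc j)) (\<lambda>x. 1 / fact (Suc j) * (of_nat (Suc j) * H x ^ (Suc j - 1) * h x))"
      by simp
    also have "(\<lambda>x. 1 / fact (Suc j) * (of_nat (Suc j) * H x ^ (Suc j - 1) * h x)) = k"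
    proof
      fix x :: real
      have "(of_nat (Suc j) :: complex) \<noteq> 0" by (simp only: of_nat_eq_0_iff)
      then show "1 / fact (Suc j) * (of_nat (Suc j) * H x ^ (Suc j - 1) * h x) = k x"
        by (simp add: k_def fact_Suc del: of_nat_Suc)
    qed
    finally show "ac_deriv (\<lambda>x. H x ^ Suc j / fact (Suc j)) k" .
  qed (simp add: H_def)
  finally show ?case by (simp add: norm_divide norm_power norm_mult del: fact_Suc)
qed

section \<open>Convergence of the series and the system for its even and odd parts\<close>

lemma A_majorant:
  "\<exists>m. summable m \<and> (\<forall>j. \<forall>x\<in>{-R..R}. norm (A j x) \<le> m j)"
proof -
  have "compact (H ` {-R..R})"
    using continuous_H continuous_on_subset by (intro compact_continuous_image) auto
  then obtain M where M: "\<And>x. x \<in> {-R..R} \<Longrightarrow> norm (H x) \<le> M"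
    using compact_imp_bounded[of "H ` {-R..R}"] unfolding bounded_pos by blast
  show ?thesis
  proof (intro exI conjI allI ballI)
    show "summable (\<lambda>j. M ^ j / fact j)" using summable_exp[of M] by (simp add: field_simps)
    fix j x assume "x \<in> {-R..R}"
    then show "norm (A j x) \<le> M ^ j / fact j"
      using norm_A_le[of j x] divide_right_mono[OF power_mono[OF M[of x] norm_ge_zero], of "fact j" j]
      by simp
  qed
qed

lemma summable_A: "summable (\<lambda>j. A j x)"
proof -
  obtain m where m: "summable m \<and> (\<forall>j. \<forall>y\<in>{-\<bar>x\<bar>..\<bar>x\<bar>}. norm (A j y) \<le> m j)"
    using A_majorant[of "\<bar>x\<bar>"] by (rule exE)
  moreover have "x \<in> {-\<bar>x\<bar>..\<bar>x\<bar>}" by auto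
  ultimately have "norm (A j x) \<le> m j" for j by blast
  then show ?thesis by (rule summable_comparison_test'[OF conjunct1[OF m], of 0])
qed

text \<open>Zeros are kept at the indices of the other parity, instead of summing over
  \<open>2 * j\<close>, so that a shift of the index by one exchanges the two kinds of
  series.\<close>

definition "C x = (\<Sum>j. if even j then A j x else 0)"
definition "S x = (\<Sum>j. if odd j then A j x else 0)"

lemma uniform_limit_A:
  "uniform_limit {-R..R} (\<lambda>n x. \<Sum>j<n. if P j then A j x else 0) (\<lambda>x. \<Sum>j. if P j then A j x else 0) sequentially"
proof -
  obtain m where m: "summable m \<and> (\<forall>j. \<forall>y\<in>{-R..R}. norm (A j y) \<le> m j)"
    using A_majorant[of R] by (rule exE)
  show ?thesis
  proof (rule Weierstrass_m_test[OF _ conjunct1[OF m]])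
    fix j x assume "x \<in> {-R..R}"
    then have "norm (A j x) \<le> m j" using m by blast
    then show "norm (if P j then A j x else 0) \<le> m j"
      using order_trans[OF norm_ge_zero, of "A j x" "m j"] by simp
  qed
qed

lemma continuous_part: "continuous_on UNIV (\<lambda>x. if P (j :: nat) then A j x else 0)"
  using continuous_A by (cases "P j") (auto intro: continuous_on_const)

lemma continuous_parity_series: "continuous_on UNIV (\<lambda>x. \<Sum>j. if P j then A j x else 0)"
proof -
  have "isCont (\<lambda>x. \<Sum>j. if P j then A j x else 0) x" for x
  proof -
    let ?R = "\<bar>x\<bar> + 1"
    have "continuous_on {-?R..?R} (\<lambda>x. \<Sum>j. if P j then A j x else 0)"
      by (rule uniform_limit_theorem[OF _ uniform_limit_A])
        (auto intro!: always_eventually continuous_on_sum continuous_on_subset[OF continuous_part])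
    then show ?thesis by (rule continuous_on_interior) auto
  qed
  then show ?thesis by (simp add: continuous_on_eq_continuous_at)
qed

lemma continuous_C: "continuous_on UNIV C" and continuous_S: "continuous_on UNIV S"
  unfolding C_def[abs_def] S_def[abs_def] by (rule continuous_parity_series)+

text \<open>Termwise integration against \<open>u\<close> raises each even index by one and gives
  all odd terms; the odd series has nothing at index 0, so the shift adds no constant.\<close>

lemma S_eq_prim: "S x = prim (\<lambda>t. u t * C t) x"
proof -
  have "(\<lambda>j. prim (\<lambda>t. u t * (if even j then A j t else 0)) x) sums prim (\<lambda>t. u t * C t) x"
    by (rule prim_sums[OF u continuous_part _ continuous_C]) (unfold C_def, rule uniform_limit_A)
  moreover have "prim (\<lambda>t. u t * (if even j then A j t else 0)) x = (if odd (Suc j) then A (Suc j) x else 0)" for j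
    by (auto simp: A_Suc prim_zero)
  ultimately have "(\<lambda>j. if odd (Suc j) then A (Suc j) x else 0) sums prim (\<lambda>t. u t * C t) x"
    by simp
  then have "(\<lambda>j. if odd j then A j x else 0) sums prim (\<lambda>t. u t * C t) x"
    by (subst (asm) sums_Suc_iff) simp
  then show ?thesis by (simp add: S_def sums_iff)
qed

lemma C_eq_prim: "C x = 1 + prim (\<lambda>t. v t * S t) x"
proof -
  have "(\<lambda>j. prim (\<lambda>t. v t * (if odd j then A j t else 0)) x) sums prim (\<lambda>t. v t * S t) x"
    by (rule prim_sums[OF v continuous_part _ continuous_S]) (unfold S_def, rule uniform_limit_A)
  moreover have "prim (\<lambda>t. v t * (if odd j then A j t else 0)) x = (if even (Suc j) then A (Suc j) x else 0)" for j
    by (auto simp: A_Suc prim_zero)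
  ultimately have "(\<lambda>j. if even (Suc j) then A (Suc j) x else 0) sums prim (\<lambda>t. v t * S t) x"
    by simp
  \<comment> \<open>Undoing the shift restores the term of index 0, which is the constant 1.\<close>
  then have "(\<lambda>j. if even j then A j x else 0) sums (1 + prim (\<lambda>t. v t * S t) x)"
    by (subst (asm) sums_Suc_iff) (simp add: A_0 add.commute)
  then show ?thesis by (simp add: C_def sums_iff)
qed

lemma ac_deriv_S: "ac_deriv S (\<lambda>x. u x * C x)"
proof -
  have "(\<lambda>x. u x * C x) \<in> L1_loc"
    using L1_loc_continuous_mult[OF u continuous_C] by (simp add: mult.commute)
  then show ?thesis using ac_deriv_prim S_eq_prim by presburger
qed

lemma ac_deriv_C: "ac_deriv C (\<lambda>x. v x * S x)"
proof -
  have "(\<lambda>x. v x * S x) \<in> L1_loc"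
    using L1_loc_continuous_mult[OF v continuous_S] by (simp add: mult.commute)
  then have "ac_deriv (\<lambda>x. 1 + prim (\<lambda>t. v t * S t) x) (\<lambda>x. 0 + v x * S x)"
    by (intro ac_deriv_add ac_deriv_const ac_deriv_prim)
  then show ?thesis by (simp add: C_eq_prim[abs_def])
qed

lemma C_0: "C 0 = 1"
  by (subst C_eq_prim) simp

lemma S_0: "S 0 = 0"
  by (subst S_eq_prim) simp

end

section \<open>Iterated integrals over simplices\<close>

text \<open>Completion leaves the measure of Borel sets unchanged, so a countable cover for
  \<open>lborel\<close> still works. Fubini over powers of \<open>lebesgue\<close> depends on
  this.\<close>

lemma sigma_finite_lebesgue: "sigma_finite_measure (lebesgue :: 'a::euclidean_space measure)"
proof
  obtain A :: "'a set set" where "countable A \<and> A \<subseteq> sets lborel \<and> \<Union> A = space lborel \<and> (\<forall>a\<in>A. emeasure lborel a \<noteq> \<infinity>)"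
    using lborel.sigma_finite_countable by blast
  then have "countable A \<and> A \<subseteq> sets lebesgue \<and> \<Union> A = space lebesgue \<and> (\<forall>a\<in>A. emeasure lebesgue a \<noteq> \<infinity>)"
    by auto
  then show "\<exists>A::'a set set. countable A \<and> A \<subseteq> sets lebesgue \<and> \<Union> A = space lebesgue \<and> (\<forall>a\<in>A. emeasure lebesgue a \<noteq> \<infinity>)" ..
qed

text \<open>Fubini with the inserted coordinate as the outer variable. This order suits the
  simplices: once the last coordinate is fixed, the inner domain is a simplex of one dimension
  less.\<close>

lemma (in product_sigma_finite) product_integral_insert_swap:
  fixes f :: "_ \<Rightarrow> _::{banach, second_countable_topology}"
  assumes I: "finite I" "i \<notin> I" and f: "integrable (Pi\<^sub>M (insert i I) M) f"
  shows "integral\<^sup>L (Pi\<^sub>M (insert i I) M) f = (\<integral>t. (\<integral>y. f (y(i := t)) \<partial>Pi\<^sub>M I M) \<partial>M i)"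
proof -
  interpret I: finite_product_sigma_finite M I by standard (rule I)
  have upd: "(\<lambda>(t, y). y(i := t)) \<in> M i \<Otimes>\<^sub>M Pi\<^sub>M I M \<rightarrow>\<^sub>M Pi\<^sub>M (insert i I) M"
    by (simp add: measurable_fun_upd case_prod_unfold)
  have m: "(\<lambda>(t, y). f (y(i := t))) \<in> borel_measurable (M i \<Otimes>\<^sub>M Pi\<^sub>M I M)"
    using measurable_compose[OF upd borel_measurable_integrable[OF f]] by (simp add: case_prod_unfold)
  have "integral\<^sup>L (Pi\<^sub>M (insert i I) M) f = integral\<^sup>L (Pi\<^sub>M ({i} \<union> I) M) f" by simp
  also have "\<dots> = (\<integral>x. (\<integral>y. f (merge {i} I (x, y)) \<partial>Pi\<^sub>M I M) \<partial>Pi\<^sub>M {i} M)"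
    using I f by (intro product_integral_fold) auto
  also have "\<dots> = (\<integral>x. (\<integral>y. f (y(i := x i)) \<partial>Pi\<^sub>M I M) \<partial>Pi\<^sub>M {i} M)"
  proof (intro Bochner_Integration.integral_cong refl)
    fix x y assume "x \<in> space (Pi\<^sub>M {i} M)" "y \<in> space (Pi\<^sub>M I M)"
    then have "merge {i} I (x, y) = y(i := x i)"
      using I by (auto simp: space_PiM merge_def fun_eq_iff PiE_def extensional_def)
    then show "f (merge {i} I (x, y)) = f (y(i := x i))" by simp
  qed
  also have "\<dots> = (\<integral>t. (\<integral>y. f (y(i := t)) \<partial>Pi\<^sub>M I M) \<partial>M i)"
    by (rule product_integral_singleton) (rule I.borel_measurable_lebesgue_integral[OF m])
  finally show ?thesis .
qed

lemma alt_prod_fun_upd_Suc: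
  "alt_prod u v (Suc j) (y(Suc j := t)) = (if even j then u t else v t) * alt_prod u v j y"
proof -
  have "alt_prod u v j (y(Suc j := t)) = alt_prod u v j y"
    unfolding alt_prod_def by (rule prod.cong) auto
  then show ?thesis by (simp add: alt_prod_def)
qed

interpretation leb: product_sigma_finite "\<lambda>i :: nat. lebesgue :: real measure"
  by (rule product_sigma_finite.intro) (rule sigma_finite_lebesgue)

text \<open>Inside the box the factors may be cut off to \<open>{a..b}\<close> without changing the
  product, and a product of integrable functions of separate coordinates is integrable.\<close>

lemma integrable_alt_prod:
  assumes u: "u \<in> L1_loc" and v: "v \<in> L1_loc" and \<Delta>: "\<Delta> \<in> sets (leb_pow n)"
    and bd: "\<And>s i. s \<in> \<Delta> \<Longrightarrow> i \<in> {1..n} \<Longrightarrow> s i \<in> {a..b}"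
  shows "set_integrable (leb_pow n) \<Delta> (alt_prod u v n)"
proof -
  define F where "F = (\<lambda>i t. indicat_real {a..b} t *\<^sub>R (if odd (i :: nat) then u t else v t))"
  have "integrable (leb_pow n) (\<lambda>s. \<Prod>i=1..n. F i (s i))"
  proof (rule leb.product_integrable_prod)
    fix i show "integrable lebesgue (F i)"
      using L1_loc_absolutely_integrable[OF u, of a b] L1_loc_absolutely_integrable[OF v, of a b]
      unfolding F_def set_integrable_def by (cases "odd i") auto
  qed simp
  from integrable_mult_indicator[OF \<Delta> this]
  have "integrable (leb_pow n) (\<lambda>s. indicat_real \<Delta> s *\<^sub>R (\<Prod>i=1..n. F i (s i)))" .
  also have "(\<lambda>s. indicat_real \<Delta> s *\<^sub>R (\<Prod>i=1..n. F i (s i))) = (\<lambda>s. indicat_real \<Delta> s *\<^sub>R alt_prod u v n s)"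
  proof
    fix s show "indicat_real \<Delta> s *\<^sub>R (\<Prod>i=1..n. F i (s i)) = indicat_real \<Delta> s *\<^sub>R alt_prod u v n s"
    proof (cases "s \<in> \<Delta>")
      case True
      then have "(\<Prod>i=1..n. F i (s i)) = alt_prod u v n s"
        unfolding alt_prod_def F_def using bd by (intro prod.cong) auto
      then show ?thesis by simp
    qed simp
  qed
  finally show ?thesis by (simp add: set_integrable_def)
qed

text \<open>Serves both half lines: the hypothesis \<open>slice\<close> is all that Fubini needs to
  know about the shape of the domain.\<close>

lemma alt_prod_integral_Suc:
  assumes u: "u \<in> L1_loc" and v: "v \<in> L1_loc" and \<Delta>': "\<Delta>' \<in> sets (leb_pow (Suc j))"
    and bd: "\<And>s i. s \<in> \<Delta>' \<Longrightarrow> i \<in> {1..Suc j} \<Longrightarrow> s i \<in> {a..b}"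
    and slice: "\<And>y t. y \<in> space (leb_pow j) \<Longrightarrow> y(Suc j := t) \<in> \<Delta>' \<longleftrightarrow> t \<in> I \<and> y \<in> \<Delta> t"
  shows "(LINT s:\<Delta>'|leb_pow (Suc j). alt_prod u v (Suc j) s) =
    (LINT t:I|lebesgue. (if even j then u t else v t) * (LINT y:\<Delta> t|leb_pow j. alt_prod u v j y))"
proof -
  have ins: "{1..Suc j} = insert (Suc j) {1..j}" by auto
  let ?f = "\<lambda>s. indicat_real \<Delta>' s *\<^sub>R alt_prod u v (Suc j) s"
  have "set_integrable (leb_pow (Suc j)) \<Delta>' (alt_prod u v (Suc j))"
    using u v \<Delta>' bd by (rule integrable_alt_prod)
  then have int: "integrable (leb_pow (Suc j)) ?f" by (simp add: set_integrable_def)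
  have "integral\<^sup>L (leb_pow (Suc j)) ?f = (\<integral>t. (\<integral>y. ?f (y(Suc j := t)) \<partial>leb_pow j) \<partial>lebesgue)"
    using leb.product_integral_insert_swap[of "{1..j}" "Suc j" ?f] int unfolding ins by simp
  also have "\<dots> = (\<integral>t. indicat_real I t *\<^sub>R ((if even j then u t else v t) *
      (\<integral>y. indicat_real (\<Delta> t) y *\<^sub>R alt_prod u v j y \<partial>leb_pow j)) \<partial>lebesgue)"
  proof (rule Bochner_Integration.integral_cong[OF refl])
    fix t :: real
    have "(\<integral>y. ?f (y(Suc j := t)) \<partial>leb_pow j) = (\<integral>y. (indicat_real I t *\<^sub>R (if even j then u t else v t)) *
        (indicat_real (\<Delta> t) y *\<^sub>R alt_prod u v j y) \<partial>leb_pow j)"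
      by (intro Bochner_Integration.integral_cong refl)
        (auto simp: alt_prod_fun_upd_Suc slice indicator_def)
    then show "(\<integral>y. ?f (y(Suc j := t)) \<partial>leb_pow j) = indicat_real I t *\<^sub>R ((if even j then u t else v t) *
      (\<integral>y. indicat_real (\<Delta> t) y *\<^sub>R alt_prod u v j y \<partial>leb_pow j))"
      by (simp only: integral_scaleR_right integral_mult_right_zero mult_scaleR_left)
  qed
  finally show ?thesis by (simp add: set_lebesgue_integral_def)
qed

section \<open>Bounds, measurability and slices of the ordered simplices\<close>

lemma simplex_pos_between:
  assumes s: "s \<in> simplex_pos n x" and i: "i \<in> {1..n}"
  shows "0 < s i \<and> s i < x"
proof
  have "1 \<le> i \<Longrightarrow> i \<le> n \<Longrightarrow> 0 < s i"
    by (induction i rule: dec_induct) (use s in \<open>auto simp: simplex_pos_def intro: less_trans\<close>)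
  then show "0 < s i" using i by simp
  have "i \<le> n \<Longrightarrow> 1 \<le> i \<Longrightarrow> s i < x"
    by (induction i rule: inc_induct) (use s in \<open>auto simp: simplex_pos_def intro: less_trans\<close>)
  then show "s i < x" using i by simp
qed

lemma simplex_neg_between:
  assumes s: "s \<in> simplex_neg n x" and i: "i \<in> {1..n}"
  shows "x < s i \<and> s i < 0"
proof
  have "1 \<le> i \<Longrightarrow> i \<le> n \<Longrightarrow> s i < 0"
    by (induction i rule: dec_induct) (use s in \<open>auto simp: simplex_neg_def intro: less_trans\<close>)
  then show "s i < 0" using i by simp
  have "i \<le> n \<Longrightarrow> 1 \<le> i \<Longrightarrow> x < s i"
    by (induction i rule: inc_induct) (use s in \<open>auto simp: simplex_neg_def intro: less_trans\<close>)
  then show "x < s i" using i by simp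
qed

text \<open>A coordinate projection is measurable into \<open>lebesgue\<close>; composing with the
  identity, measurable from \<open>lebesgue\<close> to the coarser Borel algebra, makes comparisons
  of coordinates measurable.\<close>

lemma borel_measurable_leb_pow_component:
  assumes "i \<in> {1..n}" shows "(\<lambda>s. s i) \<in> borel_measurable (leb_pow n)"
proof -
  have "(\<lambda>x. x) \<in> borel_measurable (lebesgue :: real measure)"
    by (rule measurable_completion) simp
  from measurable_compose[OF measurable_component_singleton[OF assms] this] show ?thesis .
qed

lemma simplex_pos_sets:
  assumes "1 \<le> n" shows "simplex_pos n x \<in> sets (leb_pow n)"
proof -
  have c: "i \<in> {1..n} \<Longrightarrow> (\<lambda>s. s i) \<in> borel_measurable (leb_pow n)" for i
    by (rule borel_measurable_leb_pow_component)
  have "{s \<in> space (leb_pow n). 0 < s 1} \<in> sets (leb_pow n)"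
    "{s \<in> space (leb_pow n). s n < x} \<in> sets (leb_pow n)"
    using assms by (intro borel_measurable_less c borel_measurable_const; simp)+
  moreover have "{s \<in> space (leb_pow n). \<forall>i\<in>{1..<n}. s i < s (Suc i)} \<in> sets (leb_pow n)"
    by (intro sets.sets_Collect_finite_All borel_measurable_less c) auto
  ultimately show ?thesis
    unfolding simplex_pos_def by (intro sets.sets_Collect_conj)
qed

lemma simplex_neg_sets:
  assumes "1 \<le> n" shows "simplex_neg n x \<in> sets (leb_pow n)"
proof -
  have c: "i \<in> {1..n} \<Longrightarrow> (\<lambda>s. s i) \<in> borel_measurable (leb_pow n)" for i
    by (rule borel_measurable_leb_pow_component)
  have "{s \<in> space (leb_pow n). x < s n} \<in> sets (leb_pow n)"
    "{s \<in> space (leb_pow n). s 1 < 0} \<in> sets (leb_pow n)"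
    using assms by (intro borel_measurable_less c borel_measurable_const; simp)+
  moreover have "{s \<in> space (leb_pow n). \<forall>i\<in>{1..<n}. s (Suc i) < s i} \<in> sets (leb_pow n)"
    by (intro sets.sets_Collect_finite_All borel_measurable_less c) auto
  ultimately show ?thesis
    unfolding simplex_neg_def by (intro sets.sets_Collect_conj)
qed

lemma fun_upd_mem_space_leb_pow:
  assumes "y \<in> space (leb_pow j)" shows "y(Suc j := t) \<in> space (leb_pow (Suc j))"
  using assms by (auto simp: space_PiM PiE_def extensional_def)

text \<open>The relation is left abstract to cover increasing and decreasing chains. For
  \<open>j = 0\<close> there is no link from \<open>j\<close> to \<open>Suc j\<close>, hence the
  assumption.\<close>

lemma chain_fun_upd_Suc:
  assumes "1 \<le> j"
  shows "(\<forall>i\<in>{1..<Suc j}. R ((y(Suc j := t)) i) ((y(Suc j := t)) (Suc i))) \<longleftrightarrow>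
    (\<forall>i\<in>{1..<j}. R (y i) (y (Suc i))) \<and> R (y j) t"
proof -
  have "{1..<Suc j} = insert j {1..<j}" using assms by auto
  then show ?thesis using assms by auto
qed

text \<open>For \<open>j = 0\<close> the set \<open>simplex_pos 0 t\<close> would test coordinates
  outside the empty index set, where points take an unspecified value; the correct slice is the
  one-point space.\<close>

lemma simplex_pos_slice:
  assumes "y \<in> space (leb_pow j)"
  shows "y(Suc j := t) \<in> simplex_pos (Suc j) x \<longleftrightarrow> t \<in> {0<..<x} \<and> y \<in> (if j = 0 then space (leb_pow 0) else simplex_pos j t)"
proof (cases "j = 0")
  case True
  then show ?thesis using assms fun_upd_mem_space_leb_pow[OF assms, of t] by (auto simp: simplex_pos_def)
next
  case False
  then have j: "1 \<le> j" by simp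
  have big: "y(Suc j := t) \<in> simplex_pos (Suc j) x \<longleftrightarrow> 0 < y 1 \<and> ((\<forall>i\<in>{1..<j}. y i < y (Suc i)) \<and> y j < t) \<and> t < x"
    unfolding simplex_pos_def mem_Collect_eq chain_fun_upd_Suc[OF j, of "(<)" y t]
    using fun_upd_mem_space_leb_pow[OF assms, of t] j by simp
  have small: "y \<in> simplex_pos j t \<longleftrightarrow> 0 < y 1 \<and> (\<forall>i\<in>{1..<j}. y i < y (Suc i)) \<and> y j < t"
    using assms by (simp add: simplex_pos_def)
  \<comment> \<open>The large simplex states only \<open>t < x\<close> directly; positivity of
    \<open>t\<close> is inherited along the chain from the first coordinate.\<close>
  have "0 < t" if "y \<in> simplex_pos j t"
    using simplex_pos_between[OF that, of 1] j by simp
  then show ?thesis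
    unfolding big small greaterThanLessThan_iff if_not_P[OF False] by blast
qed

lemma simplex_neg_slice:
  assumes "y \<in> space (leb_pow j)"
  shows "y(Suc j := t) \<in> simplex_neg (Suc j) x \<longleftrightarrow> t \<in> {x<..<0} \<and> y \<in> (if j = 0 then space (leb_pow 0) else simplex_neg j t)"
proof (cases "j = 0")
  case True
  then show ?thesis using assms fun_upd_mem_space_leb_pow[OF assms, of t] by (auto simp: simplex_neg_def)
next
  case False
  then have j: "1 \<le> j" by simp
  have big: "y(Suc j := t) \<in> simplex_neg (Suc j) x \<longleftrightarrow> x < t \<and> ((\<forall>i\<in>{1..<j}. y (Suc i) < y i) \<and> t < y j) \<and> y 1 < 0"
    unfolding simplex_neg_def mem_Collect_eq chain_fun_upd_Suc[OF j, of "\<lambda>a b. b < a" y t]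
    using fun_upd_mem_space_leb_pow[OF assms, of t] j by simp
  have small: "y \<in> simplex_neg j t \<longleftrightarrow> t < y j \<and> (\<forall>i\<in>{1..<j}. y (Suc i) < y i) \<and> y 1 < 0"
    using assms by (simp add: simplex_neg_def)
  have "t < 0" if "y \<in> simplex_neg j t"
    using simplex_neg_between[OF that, of 1] j by simp
  then show ?thesis
    unfolding big small greaterThanLessThan_iff if_not_P[OF False] by blast
qed

section \<open>The recursion satisfied by the simplex integrals\<close>

lemma alt_prod_integral_0: "(LINT y:space (leb_pow 0)|leb_pow 0. alt_prod u v 0 y) = 1"
proof -
  have "(LINT y:space (leb_pow 0)|leb_pow 0. alt_prod u v 0 y) = (\<integral>y. 1 \<partial>leb_pow 0)"
    unfolding set_lebesgue_integral_def
    by (intro Bochner_Integration.integral_cong) (auto simp: alt_prod_def)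
  then show ?thesis by (simp add: measure_def space_PiM)
qed

lemma A_term_pos:
  "0 \<le> t \<Longrightarrow> (LINT y:(if j = 0 then space (leb_pow 0) else simplex_pos j t)|leb_pow j. alt_prod u v j y) = A_term j u v t"
  using alt_prod_integral_0[of u v] by (cases "j = 0") (auto simp: A_term_def)

lemma A_term_neg:
  "t < 0 \<Longrightarrow> (- 1) ^ j * (LINT y:(if j = 0 then space (leb_pow 0) else simplex_neg j t)|leb_pow j. alt_prod u v j y) = A_term j u v t"
  using alt_prod_integral_0[of u v] by (cases "j = 0") (auto simp: A_term_def)

lemma A_term_Suc:
  assumes u: "u \<in> L1_loc" and v: "v \<in> L1_loc"
  shows "A_term (Suc j) u v x = prim (\<lambda>t. (if even j then u t else v t) * A_term j u v t) x"
proof (cases "0 \<le> x")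
  case True
  have "A_term (Suc j) u v x = (LINT s:simplex_pos (Suc j) x|leb_pow (Suc j). alt_prod u v (Suc j) s)"
    using True by (simp add: A_term_def)
  also have "\<dots> = (LINT t:{0<..<x}|lebesgue. (if even j then u t else v t) *
      (LINT y:(if j = 0 then space (leb_pow 0) else simplex_pos j t)|leb_pow j. alt_prod u v j y))"
  proof (rule alt_prod_integral_Suc[OF u v simplex_pos_sets _ simplex_pos_slice])
    fix s i assume "s \<in> simplex_pos (Suc j) x" "i \<in> {1..Suc j}"
    then show "s i \<in> {0..x}" using simplex_pos_between by fastforce
  qed auto
  also have "\<dots> = (LINT t:{0<..<x}|lebesgue. (if even j then u t else v t) * A_term j u v t)"
    by (intro set_lebesgue_integral_cong) (auto simp: A_term_pos simp del: One_nat_def)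
  finally show ?thesis
    using True by (simp add: prim_def interval_lebesgue_integral_def zero_ereal_def)
next
  case False
  have "A_term (Suc j) u v x = (- 1) ^ Suc j * (LINT s:simplex_neg (Suc j) x|leb_pow (Suc j). alt_prod u v (Suc j) s)"
    using False by (simp add: A_term_def)
  also have "(LINT s:simplex_neg (Suc j) x|leb_pow (Suc j). alt_prod u v (Suc j) s)
     = (LINT t:{x<..<0}|lebesgue. (if even j then u t else v t) *
      (LINT y:(if j = 0 then space (leb_pow 0) else simplex_neg j t)|leb_pow j. alt_prod u v j y))"
  proof (rule alt_prod_integral_Suc[OF u v simplex_neg_sets _ simplex_neg_slice])
    fix s i assume "s \<in> simplex_neg (Suc j) x" "i \<in> {1..Suc j}"
    then show "s i \<in> {x..0}" using simplex_neg_between by fastforce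
  qed auto
  \<comment> \<open>Of the \<open>Suc j\<close> signs, \<open>j\<close> are absorbed into
    \<open>A_term j\<close>, and the remaining one is the sign of \<open>prim\<close> to the left of
    0.\<close>
  also have "(- 1) ^ Suc j * \<dots> = - (LINT t:{x<..<0}|lebesgue. (if even j then u t else v t) * A_term j u v t)"
    (is "?L = - ?R")
  proof -
    have "?R = (LINT t:{x<..<0}|lebesgue. (- 1) ^ j * ((if even j then u t else v t) *
      (LINT y:(if j = 0 then space (leb_pow 0) else simplex_neg j t)|leb_pow j. alt_prod u v j y)))"
      by (intro set_lebesgue_integral_cong allI impI) (auto simp only: greaterThanLessThan_iff A_term_neg[symmetric] mult_ac, simp)
    then show ?thesis by (simp only: set_integral_mult_right power_Suc mult_minus1 mult_minus_left mult_1_left)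
  qed
  finally show ?thesis
    using False by (simp add: prim_def interval_lebesgue_integral_def zero_ereal_def)
qed

section \<open>Identification of \<open>C_biv\<close> and \<open>S_biv\<close> with the even and odd
  series\<close>

lemma alternating_iterates_A_term:
  "u \<in> L1_loc \<Longrightarrow> v \<in> L1_loc \<Longrightarrow> alternating_iterates u v (\<lambda>j. A_term j u v)"
  by (rule alternating_iterates.intro) (simp_all only: A_term_Suc A_term_def[of 0] simp_thms if_True)

lemma A_term_uminus: "A_term j (\<lambda>t. - u t) (\<lambda>t. - v t) x = (- 1) ^ j * A_term j u v x"
proof -
  have "alt_prod (\<lambda>t. - u t) (\<lambda>t. - v t) j s = (\<Prod>i=1..j. (- 1) * (if odd i then u (s i) else v (s i)))" for s
    unfolding alt_prod_def by (rule prod.cong) auto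
  then have "alt_prod (\<lambda>t. - u t) (\<lambda>t. - v t) j = (\<lambda>s. (- 1) ^ j * alt_prod u v j s)"
    unfolding prod.distrib by (simp add: alt_prod_def fun_eq_iff)
  then show ?thesis by (simp add: A_term_def)
qed

text \<open>By \<open>A_term_uminus\<close>, negating both functions multiplies term
  \<open>j\<close> by \<open>(- 1) ^ j\<close>, so half the sum and half the difference filter by
  parity. Splitting the sums requires convergence for the negated pair as well.\<close>

lemma C_biv_S_biv_eq_suminf:
  assumes "u \<in> L1_loc" "v \<in> L1_loc"
  shows "C_biv u v x = (\<Sum>j. if even j then A_term j u v x else 0)"
    and "S_biv u v x = (\<Sum>j. if odd j then A_term j u v x else 0)"
proof -
  interpret alternating_iterates u v "\<lambda>j. A_term j u v" by (rule alternating_iterates_A_term[OF assms])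
  let ?a = "\<lambda>j. A_term j u v x"
  have sa: "summable ?a" by (rule summable_A)
  have s': "summable (\<lambda>j. A_term j (\<lambda>t. - u t) (\<lambda>t. - v t) x)"
  proof -
    interpret m: alternating_iterates "\<lambda>t. - u t" "\<lambda>t. - v t" "\<lambda>j. A_term j (\<lambda>t. - u t) (\<lambda>t. - v t)"
      using L1_loc_cmult[OF assms(1), of "-1"] L1_loc_cmult[OF assms(2), of "-1"]
      by (intro alternating_iterates_A_term) auto
    show ?thesis by (rule m.summable_A)
  qed
  have E: "E_biv p q x = (\<Sum>j. A_term j p q x)" if "summable (\<lambda>j. A_term j p q x)" for p q
    using suminf_split_head[OF that] by (simp add: E_biv_def A_term_def[of 0])
  let ?b = "\<lambda>j. A_term j (\<lambda>t. - u t) (\<lambda>t. - v t) x"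
  have "(\<lambda>j. (?a j + ?b j) / 2) sums C_biv u v x"
    unfolding C_biv_def E[OF sa] E[OF s'] by (intro sums_divide sums_add summable_sums sa s')
  also have "(\<lambda>j. (?a j + ?b j) / 2) = (\<lambda>j. if even j then ?a j else 0)"
    by (simp add: fun_eq_iff A_term_uminus)
  finally show "C_biv u v x = (\<Sum>j. if even j then ?a j else 0)" by (rule sums_unique)
  have "(\<lambda>j. (?a j - ?b j) / 2) sums S_biv u v x"
    unfolding S_biv_def E[OF sa] E[OF s'] by (intro sums_divide sums_diff summable_sums sa s')
  also have "(\<lambda>j. (?a j - ?b j) / 2) = (\<lambda>j. if odd j then ?a j else 0)"
    by (simp add: fun_eq_iff A_term_uminus)
  finally show "S_biv u v x = (\<Sum>j. if odd j then ?a j else 0)" by (rule sums_unique)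
qed

lemma C_biv_S_biv_system:
  assumes "u \<in> L1_loc" "v \<in> L1_loc"
  shows "ac_deriv (C_biv u v) (\<lambda>x. v x * S_biv u v x)" "ac_deriv (S_biv u v) (\<lambda>x. u x * C_biv u v x)"
    "C_biv u v 0 = 1" "S_biv u v 0 = 0"
proof -
  interpret alternating_iterates u v "\<lambda>j. A_term j u v" by (rule alternating_iterates_A_term[OF assms])
  have eq: "C_biv u v = C" "S_biv u v = S"
    by (simp_all add: fun_eq_iff C_def S_def C_biv_S_biv_eq_suminf[OF assms])
  show "ac_deriv (C_biv u v) (\<lambda>x. v x * S_biv u v x)" "ac_deriv (S_biv u v) (\<lambda>x. u x * C_biv u v x)"
    "C_biv u v 0 = 1" "S_biv u v 0 = 0"
    unfolding eq by (rule ac_deriv_C ac_deriv_S C_0 S_0)+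
qed

section \<open>The second order equation\<close>

text \<open>The base point is moved to \<open>x - 1\<close>, so that \<open>x\<close> is interior to
  the interval of integration and the position of \<open>x\<close> relative to 0 is
  irrelevant.\<close>

lemma prim_has_vector_derivative:
  assumes w: "continuous_on UNIV w" shows "(prim w has_vector_derivative w x) (at x)"
proof -
  have L: "w \<in> L1_loc" by (rule L1_loc_continuous[OF w])
  have "((\<lambda>t. integral {x - 1..t} w) has_vector_derivative w x) (at x within {x - 1..x + 1})"
    using continuous_on_subset[OF w] by (intro integral_has_vector_derivative) auto
  then have "((\<lambda>t. integral {x - 1..t} w) has_vector_derivative w x) (at x)"
    by (simp add: at_within_Icc_at)
  then have "((\<lambda>t. prim w (x - 1) + integral {x - 1..t} w) has_vector_derivative 0 + w x) (at x)"
    by (rule has_vector_derivative_add[OF has_vector_derivative_const])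
  then have "((\<lambda>t. prim w (x - 1) + integral {x - 1..t} w) has_vector_derivative w x) (at x)" by simp
  then show ?thesis
  proof (rule has_vector_derivative_transform_within_open[of _ _ _ "{x - 1<..}"])
    fix t assume "t \<in> {x - 1<..}"
    then show "prim w (x - 1) + integral {x - 1..t} w = prim w t"
      using prim_diff[OF L, of "x - 1" t] by (simp add: algebra_simps)
  qed auto
qed

text \<open>Upgrades an almost everywhere derivative to one at every point: by uniqueness
  \<open>F\<close> is a constant plus the primitive of the continuous \<open>h\<close>. This yields
  the classical first derivative of the constructed solution.\<close>

lemma ac_deriv_imp_has_vector_derivative:
  assumes F: "ac_deriv F h" and h: "continuous_on UNIV h"
  shows "(F has_vector_derivative h x) (at x)"
proof -
  have "prim h t + F 0 = F t" for t
    using ac_deriv_unique[OF ac_deriv_add[OF ac_deriv_prim[OF L1_loc_continuous[OF h]] ac_deriv_const[of "F 0"]], of F t] F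
    by simp
  moreover have "((\<lambda>t. prim h t + F 0) has_vector_derivative h x + 0) (at x)"
    by (intro has_vector_derivative_add prim_has_vector_derivative[OF h] has_vector_derivative_const)
  ultimately show ?thesis by simp
qed

text \<open>The way back for a given solution: it differs from the primitive of its continuous
  derivative by a constant, now by the classical mean value argument.\<close>

lemma has_vector_derivative_imp_ac_deriv:
  assumes F: "\<And>x. (F has_vector_derivative h x) (at x)" and h: "continuous_on UNIV h"
  shows "ac_deriv F h"
proof -
  have "((\<lambda>x. F x - prim h x) has_vector_derivative 0) (at x)" for x
    using has_vector_derivative_diff[OF F prim_has_vector_derivative[OF h]] by simp
  then obtain c where c: "\<And>x. F x - prim h x = c"
    using has_vector_derivative_zero_constant[of UNIV "\<lambda>x. F x - prim h x"] by auto
  have "F = (\<lambda>x. prim h x + c)"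
  proof
    fix x show "F x = prim h x + c" using c[of x] by (simp add: algebra_simps)
  qed
  moreover have "ac_deriv (\<lambda>x. prim h x + c) (\<lambda>x. h x + 0)"
    by (intro ac_deriv_add ac_deriv_prim L1_loc_continuous[OF h] ac_deriv_const)
  ultimately show ?thesis by simp
qed

theorem theorem2:
  fixes \<alpha> \<beta> f g :: "real \<Rightarrow> complex"
  assumes "\<alpha> \<in> L1_loc" and "\<beta> \<in> L1_loc"
    and f_def: "f = (\<lambda>x. - \<beta> x * exp (prim \<alpha> x))"
    and g_def: "g = (\<lambda>x. exp (- prim \<alpha> x))"
  shows "(\<forall>a b :: complex. \<exists>y. y = (\<lambda>x. a * C_biv f g x + b * S_biv g f x) \<and>
            is_solution \<alpha> \<beta> y \<and> y 0 = a \<and> vector_derivative y (at 0) = b) \<and>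
         (\<forall>y. is_solution \<alpha> \<beta> y \<longrightarrow>
            y = (\<lambda>x. y 0 * C_biv f g x + vector_derivative y (at 0) * S_biv g f x))"
proof -
  define e where "e = (\<lambda>x. exp (prim \<alpha> x))"
  have e: "ac_deriv e (\<lambda>x. \<alpha> x * e x)"
    unfolding e_def by (rule ac_deriv_exp[OF ac_deriv_prim[OF assms(1)]])
  have g: "ac_deriv g (\<lambda>x. - \<alpha> x * g x)"
    using ac_deriv_exp[OF ac_deriv_cmult[OF ac_deriv_prim[OF assms(1)], of "-1"]] by (simp add: g_def)
  have ge: "g x * e x = 1" for x by (simp add: g_def e_def flip: exp_add)
  have f_e: "f x = - (\<beta> x * e x)" for x by (simp add: f_def e_def)
  \<comment> \<open>Differentiating \<open>g Z\<close> produces \<open>g f y\<close>; this identity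
    turns it into the term with \<beta>, while the derivative of \<open>g\<close> supplies the term
    with \<alpha>.\<close>
  have gf: "g x * f x = - \<beta> x" for x using ge[of x] by (simp add: f_e mult.left_commute[of "g x"])
  have cont_g: "continuous_on UNIV g" by (rule ac_deriv_continuous[OF g])
  have gL: "g \<in> L1_loc" by (rule L1_loc_continuous[OF cont_g])
  have "(\<lambda>x. (- e x) * \<beta> x) \<in> L1_loc"
    by (intro L1_loc_continuous_mult assms continuous_on_minus ac_deriv_continuous[OF e])
  then have fL: "f \<in> L1_loc" by (simp add: f_e[abs_def] mult.commute)
  note fg = C_biv_S_biv_system[OF fL gL] and gf_sys = C_biv_S_biv_system[OF gL fL]
  have e0: "e 0 = 1" and g0: "g 0 = 1" by (simp_all add: e_def g_def)

  have "is_solution \<alpha> \<beta> y \<and> y 0 = a \<and> vector_derivative y (at 0) = b"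
    if y: "y = (\<lambda>x. a * C_biv f g x + b * S_biv g f x)" for a b y
  proof -
    \<comment> \<open>The second component of the same combination of columns of the fundamental
      matrix. Its value at 0 is \<open>b\<close>, and \<open>g 0 = 1\<close> makes this the initial
      slope.\<close>
    define Z where "Z = (\<lambda>x. a * S_biv f g x + b * C_biv g f x)"
    have "ac_deriv y (\<lambda>x. a * (g x * S_biv f g x) + b * (g x * C_biv g f x))"
      unfolding y by (intro ac_deriv_add ac_deriv_cmult fg gf_sys)
    then have ac_y: "ac_deriv y (\<lambda>x. g x * Z x)"
      by (simp add: Z_def algebra_simps)
    have "ac_deriv Z (\<lambda>x. a * (f x * C_biv f g x) + b * (f x * S_biv g f x))"
      unfolding Z_def by (intro ac_deriv_add ac_deriv_cmult fg gf_sys)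
    then have Z: "ac_deriv Z (\<lambda>x. f x * y x)"
      by (simp add: y algebra_simps)
    have gZ: "ac_deriv (\<lambda>x. g x * Z x) (\<lambda>x. g x * (f x * y x) + - \<alpha> x * g x * Z x)"
      by (rule ac_deriv_mult[OF g Z])
    have der: "(y has_vector_derivative g x * Z x) (at x)" for x
      by (rule ac_deriv_imp_has_vector_derivative[OF ac_y ac_deriv_continuous[OF gZ]])
    then have y': "vector_derivative y (at x) = g x * Z x" for x by (rule vector_derivative_at)
    have "is_solution \<alpha> \<beta> y"
      unfolding is_solution_def Let_def y'
    proof (intro conjI)
      show "y C1_differentiable_on UNIV"
        unfolding C1_differentiable_on_def
        by (intro exI[of _ "\<lambda>x. g x * Z x"] conjI ballI der ac_deriv_continuous[OF gZ])
      show "locally_abs_continuous (\<lambda>x. g x * Z x)" using gZ by (simp add: ac_deriv_def)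
      have "AE x in lebesgue. ((\<lambda>x. g x * Z x) has_vector_derivative
          g x * (f x * y x) + - \<alpha> x * g x * Z x) (at x)"
        using gZ by (simp add: ac_deriv_def)
      then show "AE x in lebesgue. (\<lambda>x. g x * Z x) differentiable at x \<and>
          vector_derivative (\<lambda>x. g x * Z x) (at x) + \<alpha> x * (g x * Z x) + \<beta> x * y x = 0"
      proof eventually_elim
        case (elim x)
        have "g x * (f x * y x) = - \<beta> x * y x" using gf[of x] by (simp flip: mult.assoc)
        then show ?case
          using elim differentiableI_vector[OF elim] by (simp add: vector_derivative_at algebra_simps)
      qed
    qed
    then show ?thesis using fg gf_sys by (simp add: y' Z_def g0) (simp add: y)
  qed
  moreover have "y x = y 0 * C_biv f g x + vector_derivative y (at 0) * S_biv g f x"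
    if sol: "is_solution \<alpha> \<beta> y" for y x
  proof -
    define y' where "y' = (\<lambda>x. vector_derivative y (at x))"
    have C1: "y C1_differentiable_on UNIV" and lac: "locally_abs_continuous y'"
      and ode: "AE x in lebesgue. y' differentiable (at x) \<and>
           vector_derivative y' (at x) + \<alpha> x * y' x + \<beta> x * y x = 0"
      using sol by (auto simp: is_solution_def Let_def y'_def)
    have "(y has_vector_derivative y' x) (at x)" for x
      using C1 by (simp add: C1_differentiable_on_eq y'_def vector_derivative_works)
    then have ac_y: "ac_deriv y y'"
      by (rule has_vector_derivative_imp_ac_deriv[OF _ locally_abs_continuous_continuous[OF lac]])
    from ode have "AE x in lebesgue. (y' has_vector_derivative - \<alpha> x * y' x - \<beta> x * y x) (at x)"
    proof eventually_elim
      case (elim x)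
      then have "vector_derivative y' (at x) = - \<alpha> x * y' x - \<beta> x * y x"
        by (simp add: algebra_simps add_eq_0_iff2)
      with elim show ?case using vector_derivative_works[of y' "at x"] by simp
    qed
    with lac have ac_y': "ac_deriv y' (\<lambda>x. - \<alpha> x * y' x - \<beta> x * y x)"
      by (simp add: ac_deriv_def)
    \<comment> \<open>Integrating factor: the derivative of \<open>e\<close> contributes
      \<open>\<alpha> e y'\<close>, which cancels the first order term of the equation.\<close>
    define Z where "Z = (\<lambda>x. e x * y' x)"
    have Z: "ac_deriv Z (\<lambda>x. f x * y x)"
      using ac_deriv_mult[OF e ac_y'] by (simp add: Z_def f_e algebra_simps)
    have "g x * Z x = y' x" for x
      using ge[of x] by (simp add: Z_def flip: mult.assoc)
    with ac_y have y: "ac_deriv y (\<lambda>x. g x * Z x)" by simp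
    have const: "F x = F 0" if "ac_deriv F h" "\<And>x. h x = 0" for F h
    proof -
      have "h = (\<lambda>x. 0)" using that(2) by (rule ext)
      with that(1) show ?thesis using ac_deriv_zero_constant[of F x 0] by simp
    qed
    have 1: "C_biv f g x * C_biv g f x - S_biv g f x * S_biv f g x = 1"
      using const[OF ac_deriv_diff[OF ac_deriv_mult[OF fg(1) gf_sys(1)] ac_deriv_mult[OF gf_sys(2) fg(2)]]] fg gf_sys
      by (simp add: algebra_simps)
    have 2: "y x * C_biv g f x - Z x * S_biv g f x = y 0"
      using const[OF ac_deriv_diff[OF ac_deriv_mult[OF y gf_sys(1)] ac_deriv_mult[OF Z gf_sys(2)]]] gf_sys
      by (simp add: algebra_simps)
    have 3: "Z x * C_biv f g x - y x * S_biv f g x = y' 0"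
      using const[OF ac_deriv_diff[OF ac_deriv_mult[OF Z fg(1)] ac_deriv_mult[OF y fg(2)]]] fg e0
      by (simp add: algebra_simps Z_def)
    \<comment> \<open>Cramer's rule: multiplying the two constants back by the first row of the
      fundamental matrix, the terms with \<open>Z\<close> cancel and the determinant
      remains.\<close>
    have "y x = y x * (C_biv f g x * C_biv g f x - S_biv g f x * S_biv f g x)" by (simp add: 1)
    also have "\<dots> = (y x * C_biv g f x - Z x * S_biv g f x) * C_biv f g x
        + (Z x * C_biv f g x - y x * S_biv f g x) * S_biv g f x"
      by (simp add: algebra_simps)
    finally show ?thesis unfolding 2 3 by (simp add: y'_def)
  qed
  ultimately show ?thesis by (intro conjI allI impI exI ext) (rule refl, auto)
qed

end
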